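(* Let $N\ge3$. For $i\in\mathbb{Z}/N\mathbb{Z}$ put $$\mathcal{A}^{i-1}_i=e_q(-\hat x_{i+1})\cdots e_q(-\hat x_{i+N-2})\cdot e_q(-\hat x_{i+N-1})\cdot e_q(-\hat x_{i+N-2})^{-1}\cdots e_q(-\hat x_{i+1})^{-1}\cdot e_q(-\hat x_i)\cdot e_q(-\hat x_{i+1})\cdots e_q(-\hat x_{i+N-2}),$$ $$\mathcal{B}_i=e_q(-\hat x_{i+1})\cdots e_q(-\hat x_{i+N-2})\,e_q(-\hat x_{i+N-1})\cdot e_q(-\hat x_{i+N-2}\cdots\hat x_{i+1}\hat x_i)\cdots e_q(-\hat x_{i+1}\hat x_i)\,e_q(-\hat x_i),$$ $$\mathcal{B}^i=e_q(-\hat x_{i+N})\,e_q(-\hat x_{i+N}\hat x_{i+N-1})\cdots e_q(-\hat x_{i+N}\hat x_{i+N-1}\cdots\hat x_{i+2})\cdot e_q(-\hat x_{i+1})\,e_q(-\hat x_{i+2})\cdots e_q(-\hat x_{i+N-1}).$$ Then for every $i\in\mathbb{Z}/N\mathbb{Z}$, $$\mathcal{A}^{i-1}_i=\mathcal{B}_i=\mathcal{B}^i .$$ Hence $\mathcal{B}_i=\mathcal{B}^i$ is invariant under the Dynkin automorphism group $\langle\pi,s_0\rangle$, i.e. $\pi(\mathcal{B}_i)=s_0(\mathcal{B}_i)=\mathcal{B}_i$, where $\pi$ is the algebra automorphism with $\pi(\hat x_i)=\hat x_{i+1}$ and $s_0$ is the algebra anti-automorphism with $s_0(\hat x_i)=\hat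 x_{-i}$.
   Context: Let $0<|q|<1$. Indices are in $\mathbb{Z}/N\mathbb{Z}$. The $\hat x_i$ are $q$-commuting variables with $$\hat x_i\hat x_j=q^{\delta_{i,j-1}-\delta_{i-1,j}}\,\hat x_j\hat x_i$$ (Kronecker delta mod $N$); concretely $\hat x_i=\alpha_i x_iq^{\vartheta_i-\vartheta_{i-1}}$ with commuting variables $x_i$, $\vartheta_i=x_i\frac{\partial}{\partial x_i}$, and nonzero constants $\alpha_i$. $e_q(z)=\sum_{n\ge0}\frac{z^n}{(q;q)_n}$ with $(q;q)_n=\prod_{k=1}^n(1-q^k)$, regarded as a formal power series in the $\hat x$'s (identities hold in the completion by degree of the algebra generated by the $\hat x_i$). *)

theory Defs
  imports Complex_Main "HOL-Algebra.QuotRing" "Berlekamp_Zassenhaus.Finite_Field"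
begin

text \<open>
  The index set \<open>\<int>/N\<int>\<close> is the type \<^typ>\<open>'n mod_ring\<close> with \<open>N = CARD('n)\<close>; all index
  arithmetic takes place there.  An exponent assigns a natural number to every index.
\<close>

type_synonym 'n expo = "'n mod_ring \<Rightarrow> nat"
type_synonym 'n series = "'n expo \<Rightarrow> complex"

definition edeg :: "'n::nontriv expo \<Rightarrow> nat" where
  "edeg a = (\<Sum>i\<in>UNIV. a i)"

text \<open>
  The completed algebra.  A series \<open>f\<close> stands for \<open>\<Sum>a. f a \<cdot> M\<^sub>a\<close>, where
  \<open>M\<^sub>a = (\<Prod>i. x\<^sub>i ^ a\<^sub>i) \<cdot> q ^ (\<Sum>i. a\<^sub>i (\<theta>\<^sub>i - \<theta>\<^sub>i\<^sub>-\<^sub>1))\<close> and \<open>\<theta>\<^sub>i = x\<^sub>i \<partial>/\<partial>x\<^sub>i\<close>.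
  Moving the \<open>q\<close>-part of \<open>M\<^sub>a\<close> past the monomial \<open>\<Prod>i. x\<^sub>i ^ b\<^sub>i\<close> produces the scalar in
  \<open>M\<^sub>a M\<^sub>b = q ^ (\<Sum>i. a\<^sub>i (b\<^sub>i - b\<^sub>i\<^sub>-\<^sub>1)) \<cdot> M\<^sub>a\<^sub>+\<^sub>b\<close>.  The \<open>M\<^sub>a\<close> form a basis of the algebra generated by
  the generators \<open>xhat\<close> below, and there are finitely many of them in each degree, so
  its completion by degree consists of all families of coefficients.
\<close>

definition qpairing :: "'n::nontriv expo \<Rightarrow> 'n expo \<Rightarrow> int" where
  "qpairing a b = (\<Sum>i\<in>UNIV. int (a i) * (int (b i) - int (b (i - 1))))"

definition qseries :: "complex \<Rightarrow> 'n::nontriv series ring" where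
  "qseries q = \<lparr>carrier = UNIV,
     monoid.mult = (\<lambda>f g c. \<Sum>(a, b) | (\<lambda>i. a i + b i) = c. q powi qpairing a b * (f a * g b)),
     monoid.one = (\<lambda>a. if a = (\<lambda>i. 0) then 1 else 0),
     ring.zero = (\<lambda>a. 0),
     ring.add = (\<lambda>f g a. f a + g a)\<rparr>"

definition smul :: "complex \<Rightarrow> 'n::nontriv series \<Rightarrow> 'n series" where
  "smul c f = (\<lambda>a. c * f a)"

definition unit_expo :: "'n::nontriv mod_ring \<Rightarrow> 'n expo" where
  "unit_expo i = (\<lambda>j. if j = i then 1 else 0)"

text \<open>\<open>\<alpha>\<^sub>i \<cdot> x\<^sub>i \<cdot> q ^ (\<theta>\<^sub>i - \<theta>\<^sub>i\<^sub>-\<^sub>1)\<close>\<close>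

definition xhat :: "('n::nontriv mod_ring \<Rightarrow> complex) \<Rightarrow> 'n mod_ring \<Rightarrow> 'n series" where
  "xhat \<alpha> i = (\<lambda>a. if a = unit_expo i then \<alpha> i else 0)"

definition qpoch :: "complex \<Rightarrow> nat \<Rightarrow> complex" where
  "qpoch q n = (\<Prod>k=1..n. 1 - q ^ k)"

text \<open>
  The sum over \<open>n\<close> is taken coefficientwise.  For \<open>z\<close> without constant term, the only case used,
  the \<open>n\<close>-th power of \<open>z\<close> starts in degree \<open>n\<close>, so every coefficient is a finite sum.
\<close>

definition qexp :: "complex \<Rightarrow> 'n::nontriv series \<Rightarrow> 'n series" where
  "qexp q z = (\<lambda>a. \<Sum>n. (z [^]\<^bsub>qseries q\<^esub> n) a / qpoch q n)"

text \<open>Product of a list of factors, in the order of the list.\<close>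

definition ordprod :: "complex \<Rightarrow> 'n::nontriv series list \<Rightarrow> 'n series" where
  "ordprod q fs = foldr (\<lambda>f g. f \<otimes>\<^bsub>qseries q\<^esub> g) fs \<one>\<^bsub>qseries q\<^esub>"

text \<open>\<open>eneg q f = e\<^sub>q(-f)\<close>\<close>

definition eneg :: "complex \<Rightarrow> 'n::nontriv series \<Rightarrow> 'n series" where
  "eneg q f = qexp q (\<ominus>\<^bsub>qseries q\<^esub> f)"

definition prodA :: "complex \<Rightarrow> ('n::nontriv mod_ring \<Rightarrow> complex) \<Rightarrow> 'n mod_ring \<Rightarrow> 'n series" where
  "prodA q \<alpha> i = ordprod q
     (map (\<lambda>k. eneg q (xhat \<alpha> (i + of_nat k))) [1..<CARD('n) - 1]
      @ [eneg q (xhat \<alpha> (i + of_nat (CARD('n) - 1)))]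
      @ map (\<lambda>k. inv\<^bsub>qseries q\<^esub> (eneg q (xhat \<alpha> (i + of_nat k)))) (rev [1..<CARD('n) - 1])
      @ [eneg q (xhat \<alpha> i)]
      @ map (\<lambda>k. eneg q (xhat \<alpha> (i + of_nat k))) [1..<CARD('n) - 1])"

text \<open>\<open>desc_prod q \<alpha> i m\<close> is the descending product of the \<open>m + 1\<close> generators with indices \<open>i, i - 1, \<dots>, i - m\<close>.\<close>

definition desc_prod :: "complex \<Rightarrow> ('n::nontriv mod_ring \<Rightarrow> complex) \<Rightarrow> 'n mod_ring \<Rightarrow> nat \<Rightarrow> 'n series" where
  "desc_prod q \<alpha> i m = ordprod q (map (\<lambda>k. xhat \<alpha> (i - of_nat k)) [0..<m + 1])"

definition prodB_lower :: "complex \<Rightarrow> ('n::nontriv mod_ring \<Rightarrow> complex) \<Rightarrow> 'n mod_ring \<Rightarrow> 'n series" where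
  "prodB_lower q \<alpha> i = ordprod q
     (map (\<lambda>k. eneg q (xhat \<alpha> (i + of_nat k))) [1..<CARD('n)]
      @ map (\<lambda>m. eneg q (desc_prod q \<alpha> (i + of_nat m) m)) (rev [0..<CARD('n) - 1]))"

definition prodB_upper :: "complex \<Rightarrow> ('n::nontriv mod_ring \<Rightarrow> complex) \<Rightarrow> 'n mod_ring \<Rightarrow> 'n series" where
  "prodB_upper q \<alpha> i = ordprod q
     (map (\<lambda>m. eneg q (desc_prod q \<alpha> (i + of_nat CARD('n)) m)) [0..<CARD('n) - 1]
      @ map (\<lambda>k. eneg q (xhat \<alpha> (i + of_nat k))) [1..<CARD('n)])"

definition opposite_ring :: "('a, 'b) ring_scheme \<Rightarrow> ('a, 'b) ring_scheme" where
  "opposite_ring R = R\<lparr>monoid.mult := (\<lambda>x y. y \<otimes>\<^bsub>R\<^esub> x)\<rparr>"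

text \<open>
  Algebra isomorphisms of the completed algebras: complex-linear ring isomorphisms, continuous
  for the degree topology (a basis of neighbourhoods of 0 is given by the series starting in
  degree \<open>m\<close>), so that they are determined by their values on the generators.  An algebra
  anti-automorphism is an isomorphism onto the opposite ring.
\<close>

definition alg_iso :: "'n::nontriv series ring \<Rightarrow> 'n series ring \<Rightarrow> ('n series \<Rightarrow> 'n series) \<Rightarrow> bool" where
  "alg_iso R S \<phi> \<longleftrightarrow> \<phi> \<in> ring_iso R S \<and> (\<forall>c f. \<phi> (smul c f) = smul c (\<phi> f)) \<and>
     (\<forall>n. \<exists>m. \<forall>f. (\<forall>a. edeg a < m \<longrightarrow> f a = 0) \<longrightarrow> (\<forall>a. edeg a < n \<longrightarrow> \<phi> f a = 0))"

text \<open>Existence and uniqueness are shown in \<open>dynkin_pi_ex1\<close> and \<open>dynkin_s0_ex1\<close> below.\<close>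

definition dynkin_pi :: "complex \<Rightarrow> ('n::nontriv mod_ring \<Rightarrow> complex) \<Rightarrow> 'n series \<Rightarrow> 'n series" where
  "dynkin_pi q \<alpha> = (THE \<phi>. alg_iso (qseries q) (qseries q) \<phi> \<and>
      (\<forall>i. \<phi> (xhat \<alpha> i) = xhat \<alpha> (i + 1)))"

definition dynkin_s0 :: "complex \<Rightarrow> ('n::nontriv mod_ring \<Rightarrow> complex) \<Rightarrow> 'n series \<Rightarrow> 'n series" where
  "dynkin_s0 q \<alpha> = (THE \<phi>. alg_iso (qseries q) (opposite_ring (qseries q)) \<phi> \<and>
      (\<forall>i. \<phi> (xhat \<alpha> i) = xhat \<alpha> (- i)))"


lemma qseries_sel [simp]:
  "carrier (qseries q) = UNIV"
  "\<one>\<^bsub>qseries q\<^esub> = (\<lambda>a. if a = (\<lambda>i. 0) then 1 else 0)"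
  "\<zero>\<^bsub>qseries q\<^esub> = (\<lambda>a. 0)"
  "f \<oplus>\<^bsub>qseries q\<^esub> g = (\<lambda>a. f a + g a)"
  by (simp_all add: qseries_def)

lemma mult_qseries:
  "(f \<otimes>\<^bsub>qseries q\<^esub> g) c =
     (\<Sum>(a, b) | (\<lambda>i. a i + b i) = c. q powi qpairing a b * (f a * g b))"
  by (simp add: qseries_def)

lemma finite_expo_le: "finite {a :: 'n::nontriv expo. \<forall>i. a i \<le> c i}"
proof -
  have "{a. \<forall>i. a i \<le> c i} = Pi\<^sub>E UNIV (\<lambda>i. {..c i})"
    by (auto simp: PiE_def Pi_def)
  then show ?thesis by (simp add: finite_PiE)
qed

lemma finite_expo_deg: "finite {a :: 'n::nontriv expo. edeg a < m}"
proof (rule finite_subset[OF _ finite_expo_le[of "\<lambda>i. m"]])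
  show "{a :: 'n expo. edeg a < m} \<subseteq> {a. \<forall>i. a i \<le> m}"
  proof clarify
    fix a :: "'n expo" and i
    assume "edeg a < m"
    moreover have "a i \<le> edeg a" unfolding edeg_def by (rule member_le_sum) auto
    ultimately show "a i \<le> m" by simp
  qed
qed

lemma finite_expo_split: "finite {(a, b). (\<lambda>i. a i + b i) = (c :: 'n::nontriv expo)}"
proof (rule finite_subset)
  show "{(a, b). (\<lambda>i. a i + b i) = c} \<subseteq> {a. \<forall>i. a i \<le> c i} \<times> {a. \<forall>i. a i \<le> c i}"
    by auto
qed (simp add: finite_expo_le)

lemma finite_expo_split': "finite {p. (\<lambda>i. fst p i + snd p i) = (c :: 'n::nontriv expo)}"
  using finite_expo_split[of c] by (simp add: case_prod_beta')

lemma qpairing_add_left: "qpairing (\<lambda>i. a i + b i) c = qpairing a c + qpairing b c"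
  by (simp add: qpairing_def sum.distrib [symmetric] algebra_simps)

lemma qpairing_add_right: "qpairing a (\<lambda>i. b i + c i) = qpairing a b + qpairing a c"
  by (simp add: qpairing_def sum.distrib [symmetric] algebra_simps)

lemma qpairing_zero [simp]: "qpairing (\<lambda>i. 0) a = 0" "qpairing a (\<lambda>i. 0) = 0"
  by (simp_all add: qpairing_def)

lemma expo_add_left_cancel:
  "((\<lambda>i. a i + b i) = (\<lambda>i. a i + c i)) \<longleftrightarrow> b = (c :: 'n expo)"
  by (auto simp: fun_eq_iff)

lemma mult_qseries_assoc:
  assumes "q \<noteq> 0"
  shows "(f \<otimes>\<^bsub>qseries q\<^esub> g) \<otimes>\<^bsub>qseries q\<^esub> h = f \<otimes>\<^bsub>qseries q\<^esub> (g \<otimes>\<^bsub>qseries q\<^esub> h)"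
    (is "?L = ?R")
proof
  fix c :: "'a expo"
  define P where "P d = {(a, b). (\<lambda>i. a i + b i) = (d :: 'a expo)}" for d
  have fin: "finite (P d)" for d unfolding P_def by (rule finite_expo_split)
  define t where "t = (\<lambda>a b d. q powi (qpairing a b + qpairing a d + qpairing b d) * (f a * g b * h d))"
  have "?L c = (\<Sum>p\<in>P c. \<Sum>r\<in>P (fst p). t (fst r) (snd r) (snd p))"
    unfolding mult_qseries P_def[symmetric]
    by (intro sum.cong refl)
       (auto simp: case_prod_beta sum_distrib_left sum_distrib_right P_def t_def
          qpairing_add_left power_int_add assms algebra_simps intro!: sum.cong)
  also have "\<dots> = (\<Sum>(p, r)\<in>Sigma (P c) (\<lambda>p. P (fst p)). t (fst r) (snd r) (snd p))"
    by (rule sum.Sigma) (auto simp: fin)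
  also have "\<dots> = (\<Sum>(p, r)\<in>Sigma (P c) (\<lambda>p. P (snd p)). t (fst p) (fst r) (snd r))"
    by (rule sum.reindex_bij_witness[where
          i = "\<lambda>((a, s), (b, d)). ((\<lambda>i. a i + b i, d), (a, b))" and
          j = "\<lambda>((s, d), (a, b)). ((a, \<lambda>i. b i + d i), (b, d))"])
       (auto simp: P_def add.assoc)
  also have "\<dots> = (\<Sum>p\<in>P c. \<Sum>r\<in>P (snd p). t (fst p) (fst r) (snd r))"
    by (rule sum.Sigma[symmetric]) (auto simp: fin)
  also have "\<dots> = ?R c"
    unfolding mult_qseries P_def[symmetric]
    by (intro sum.cong refl)
       (auto simp: case_prod_beta sum_distrib_left sum_distrib_right P_def t_def
          qpairing_add_right power_int_add assms algebra_simps intro!: sum.cong)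
  finally show "?L c = ?R c" .
qed

definition basis_mono :: "'n::nontriv expo \<Rightarrow> 'n series" where
  "basis_mono a = (\<lambda>b. if b = a then 1 else 0)"

lemma basis_mono_mult_left:
  "(basis_mono a \<otimes>\<^bsub>qseries q\<^esub> g) (\<lambda>i. a i + b i) = q powi qpairing a b * g b"
proof -
  have "(basis_mono a \<otimes>\<^bsub>qseries q\<^esub> g) (\<lambda>i. a i + b i) =
      (\<Sum>p\<in>{(a, b)}. q powi qpairing (fst p) (snd p) * (basis_mono a (fst p) * g (snd p)))"
    unfolding mult_qseries case_prod_beta
    by (rule sum.mono_neutral_right)
       (auto simp: finite_expo_split' basis_mono_def expo_add_left_cancel
          split: if_splits)
  then show ?thesis by (simp add: basis_mono_def)
qed

lemma basis_mono_mult_mono: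
  "basis_mono a \<otimes>\<^bsub>qseries q\<^esub> basis_mono b = smul (q powi qpairing a b) (basis_mono (\<lambda>i. a i + b i))"
proof
  fix c
  have "(basis_mono a \<otimes>\<^bsub>qseries q\<^esub> basis_mono b) c =
      (\<Sum>p | (\<lambda>i. fst p i + snd p i) = c.
         if p = (a, b) then q powi qpairing a b else 0)"
    unfolding mult_qseries case_prod_beta
    by (rule sum.cong) (auto simp: basis_mono_def split: if_splits)
  also have "\<dots> = (if (\<lambda>i. a i + b i) = c then q powi qpairing a b else 0)"
    by (subst sum.delta) (auto simp: finite_expo_split')
  finally show "(basis_mono a \<otimes>\<^bsub>qseries q\<^esub> basis_mono b) c =
      smul (q powi qpairing a b) (basis_mono (\<lambda>i. a i + b i)) c"
    by (auto simp: smul_def basis_mono_def)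
qed

lemma smul_mult:
  "smul c f \<otimes>\<^bsub>qseries q\<^esub> g = smul c (f \<otimes>\<^bsub>qseries q\<^esub> g)"
  "f \<otimes>\<^bsub>qseries q\<^esub> smul c g = smul c (f \<otimes>\<^bsub>qseries q\<^esub> g)"
  by (auto simp: fun_eq_iff mult_qseries smul_def sum_distrib_left case_prod_beta algebra_simps
      intro!: sum.cong)

lemma one_qseries_basis_mono: "\<one>\<^bsub>qseries q\<^esub> = basis_mono (\<lambda>i. 0)"
  by (simp add: basis_mono_def)

lemma one_mult_qseries: "\<one>\<^bsub>qseries q\<^esub> \<otimes>\<^bsub>qseries q\<^esub> g = g"
proof
  fix b
  show "(\<one>\<^bsub>qseries q\<^esub> \<otimes>\<^bsub>qseries q\<^esub> g) b = g b"
    using basis_mono_mult_left[where a = "\<lambda>i. 0" and q = q and g = g and b = b] by (simp only: one_qseries_basis_mono) simp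
qed

lemma mult_qseries_one: "g \<otimes>\<^bsub>qseries q\<^esub> \<one>\<^bsub>qseries q\<^esub> = g"
proof
  fix b :: "'a expo"
  have "(g \<otimes>\<^bsub>qseries q\<^esub> \<one>\<^bsub>qseries q\<^esub>) b =
      (\<Sum>p\<in>{(b, \<lambda>i. 0)}. q powi qpairing (fst p) (snd p) * (g (fst p) * basis_mono (\<lambda>i. 0) (snd p)))"
    unfolding mult_qseries case_prod_beta one_qseries_basis_mono
    by (rule sum.mono_neutral_right)
       (auto simp: finite_expo_split' basis_mono_def split: if_splits)
  then show "(g \<otimes>\<^bsub>qseries q\<^esub> \<one>\<^bsub>qseries q\<^esub>) b = g b" by (simp add: basis_mono_def)
qed

lemma ring_qseries:
  assumes "q \<noteq> 0"
  shows "ring (qseries q :: 'n::nontriv series ring)"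
proof (rule ringI)
  show "abelian_group (qseries q :: 'n series ring)"
  proof (rule abelian_groupI, goal_cases)
    case (6 x)
    show ?case by (rule bexI[of _ "\<lambda>a. - x a"]) auto
  qed (auto simp: algebra_simps)
  show "monoid (qseries q :: 'n series ring)"
    by (rule monoidI)
       (auto simp: mult_qseries_assoc[OF assms] one_mult_qseries mult_qseries_one simp del: qseries_sel(2))
qed (auto simp: fun_eq_iff mult_qseries sum.distrib[symmetric] algebra_simps case_prod_beta)

lemma neg_qseries:
  assumes "q \<noteq> 0"
  shows "\<ominus>\<^bsub>qseries q\<^esub> f = (\<lambda>a. - f a)"
proof -
  interpret ring "qseries q" by (rule ring_qseries[OF assms])
  show ?thesis by (rule minus_equality) auto
qed

lemma xhat_basis_mono: "xhat \<alpha> i = smul (\<alpha> i) (basis_mono (unit_expo i))"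
  by (auto simp: xhat_def smul_def basis_mono_def)

lemma qpairing_unit:
  "qpairing (unit_expo i) b = int (b i) - int (b (i - 1))"
proof -
  have "qpairing (unit_expo i) b = (\<Sum>j\<in>UNIV. if j = i then int (b j) - int (b (j - 1)) else 0)"
    unfolding qpairing_def by (rule sum.cong) (auto simp: unit_expo_def)
  then show ?thesis by simp
qed

text \<open>The defining commutation relations of the generators.\<close>

lemma xhat_commute:
  assumes "q \<noteq> 0"
  shows "xhat \<alpha> i \<otimes>\<^bsub>qseries q\<^esub> xhat \<alpha> j =
    smul (q powi ((if i = j - 1 then 1 else 0) - (if i - 1 = j then 1 else 0)))
      (xhat \<alpha> j \<otimes>\<^bsub>qseries q\<^esub> xhat \<alpha> i)"
proof -
  have "qpairing (unit_expo i) (unit_expo j) =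
     ((if i = j - 1 then 1 else 0) - (if i - 1 = j then 1 else 0)) + qpairing (unit_expo j) (unit_expo i)"
    unfolding qpairing_unit by (auto simp: unit_expo_def eq_diff_eq diff_eq_eq)
  then have "q powi qpairing (unit_expo i) (unit_expo j) =
     q powi ((if i = j - 1 then 1 else 0) - (if i - 1 = j then 1 else 0))
       * q powi qpairing (unit_expo j) (unit_expo i)"
    by (simp only: power_int_add[OF disjI1[OF assms]])
  moreover have "(\<lambda>k. unit_expo i k + unit_expo j k) = (\<lambda>k. unit_expo j k + unit_expo i k)"
    by (simp add: add.commute)
  ultimately show ?thesis
    by (simp add: xhat_basis_mono smul_mult basis_mono_mult_mono) (simp add: smul_def mult_ac)
qed

lemma alg_iso_unique:
  fixes \<phi> \<psi> :: "'n::nontriv series \<Rightarrow> 'n series"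
  assumes q: "q \<noteq> 0" and \<alpha>: "\<And>i. \<alpha> i \<noteq> 0"
    and S: "carrier S = UNIV" "\<And>f g. f \<oplus>\<^bsub>S\<^esub> g = (\<lambda>a. f a + g a)"
    and phi: "alg_iso (qseries q) S \<phi>" and psi: "alg_iso (qseries q) S \<psi>"
    and eq: "\<And>i. \<phi> (xhat \<alpha> i) = \<psi> (xhat \<alpha> i)"
  shows "\<phi> = \<psi>"
proof -
  have hom: "\<phi> \<in> Ring.ring_hom (qseries q) S" "\<psi> \<in> Ring.ring_hom (qseries q) S"
    using phi psi by (auto simp: alg_iso_def ring_iso_def)
  have lin: "\<phi> (smul c f) = smul c (\<phi> f)" "\<psi> (smul c f) = smul c (\<psi> f)" for c f
    using phi psi by (auto simp: alg_iso_def)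
  have add: "\<phi> (\<lambda>a. f a + g a) = (\<lambda>a. \<phi> f a + \<phi> g a)" "\<psi> (\<lambda>a. f a + g a) = (\<lambda>a. \<psi> f a + \<psi> g a)" for f g
    using Ring.ring_hom_add[OF hom(1), of f g] Ring.ring_hom_add[OF hom(2), of f g] by (auto simp: S)
  have mon: "\<phi> (basis_mono a) = \<psi> (basis_mono a)" for a
  proof (induction "edeg a" arbitrary: a)
    case 0
    then have "basis_mono a = \<one>\<^bsub>qseries q\<^esub>"
      by (auto simp: edeg_def basis_mono_def fun_eq_iff)
    then show ?case using hom by (simp only: Ring.ring_hom_one)
  next
    case (Suc n)
    have "\<exists>i. a i \<noteq> 0" using Suc.hyps(2) by (rule_tac ccontr) (auto simp: edeg_def)
    then obtain i where i: "a i \<noteq> 0" by blast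
    define b where "b = (\<lambda>j. a j - unit_expo i j)"
    have a: "a = (\<lambda>j. unit_expo i j + b j)"
      using i by (auto simp: b_def unit_expo_def fun_eq_iff)
    have "edeg a = edeg (unit_expo i) + edeg b"
      unfolding edeg_def by (subst a) (simp add: sum.distrib)
    moreover have "edeg (unit_expo i) = 1"
      by (simp add: edeg_def unit_expo_def)
    ultimately have "\<phi> (basis_mono b) = \<psi> (basis_mono b)" using Suc by auto
    moreover have "basis_mono a = smul (1 / (\<alpha> i * q powi qpairing (unit_expo i) b))
        (xhat \<alpha> i \<otimes>\<^bsub>qseries q\<^esub> basis_mono b)"
      using q \<alpha>[of i] by (subst a) (simp add: xhat_basis_mono smul_mult basis_mono_mult_mono, simp add: smul_def)
    ultimately show ?case using hom eq[of i] by (simp add: lin Ring.ring_hom_mult)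
  qed
  have fin: "\<phi> f = \<psi> f" if "finite A" "\<And>a. a \<notin> A \<Longrightarrow> f a = 0" for f A
    using that
  proof (induction A arbitrary: f rule: finite_induct)
    case empty
    then have "f = smul 0 (basis_mono (\<lambda>i. 0))" by (auto simp: smul_def)
    then show ?case by (simp only: lin mon)
  next
    case (insert x A)
    have "f = (\<lambda>a. (f(x := 0)) a + smul (f x) (basis_mono x) a)"
      by (auto simp: smul_def basis_mono_def)
    moreover have "\<phi> (f(x := 0)) = \<psi> (f(x := 0))"
      by (rule insert.IH) (use insert in auto)
    ultimately show ?case by (metis add lin mon)
  qed
  show ?thesis
  proof (rule ext, rule ext)
    fix f :: "'n series" and c :: "'n expo"
    obtain m1 where m1: "\<And>f. (\<forall>a. edeg a < m1 \<longrightarrow> f a = 0) \<Longrightarrow> (\<forall>a. edeg a < Suc (edeg c) \<longrightarrow> \<phi> f a = 0)"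
      using phi unfolding alg_iso_def by meson
    obtain m2 where m2: "\<And>f. (\<forall>a. edeg a < m2 \<longrightarrow> f a = 0) \<Longrightarrow> (\<forall>a. edeg a < Suc (edeg c) \<longrightarrow> \<psi> f a = 0)"
      using psi unfolding alg_iso_def by meson
    define m where "m = max m1 m2"
    define g where "g = (\<lambda>a. if edeg a < m then f a else 0)"
    define h where "h = (\<lambda>a. if edeg a < m then 0 else f a)"
    have "f = (\<lambda>a. g a + h a)" by (auto simp: g_def h_def)
    then have "\<phi> f = (\<lambda>a. \<phi> g a + \<phi> h a)" "\<psi> f = (\<lambda>a. \<psi> g a + \<psi> h a)"
      by (metis add)+
    moreover have "\<phi> g = \<psi> g"
      by (rule fin[OF finite_expo_deg[of m]]) (auto simp: g_def)
    moreover have "\<phi> h c = 0" by (rule m1[rule_format]) (auto simp: h_def m_def)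
    moreover have "\<psi> h c = 0" by (rule m2[rule_format]) (auto simp: h_def m_def)
    ultimately show "\<phi> f c = \<psi> f c" by simp
  qed
qed

text \<open>The substitution sending the generator with index \<open>i\<close> to the one with index \<open>\<tau> i\<close>.\<close>

definition relabel :: "('n::nontriv mod_ring \<Rightarrow> complex) \<Rightarrow> ('n mod_ring \<Rightarrow> 'n mod_ring) \<Rightarrow> 'n series \<Rightarrow> 'n series" where
  "relabel w \<tau> f = (\<lambda>b. (\<Prod>j\<in>UNIV. w j ^ b j) * f (\<lambda>i. b (\<tau> i)))"

lemma relabel_alg_iso:
  fixes S :: "'n::nontriv series ring" and \<tau> :: "'n mod_ring \<Rightarrow> 'n mod_ring"
  assumes \<tau>: "\<And>i. \<tau> (\<sigma> i) = i" "\<And>i. \<sigma> (\<tau> i) = i"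
    and w: "\<And>i. w i \<noteq> 0"
    and S: "carrier S = UNIV" "\<And>f g. f \<oplus>\<^bsub>S\<^esub> g = (\<lambda>a. f a + g a)" "\<one>\<^bsub>S\<^esub> = \<one>\<^bsub>qseries q\<^esub>"
    and mult: "\<And>f g c. (f \<otimes>\<^bsub>S\<^esub> g) c = (\<Sum>(a, b) | (\<lambda>i. a i + b i) = c.
        q powi qpairing (\<lambda>i. a (\<tau> i)) (\<lambda>i. b (\<tau> i)) * (f a * g b))"
  shows "alg_iso (qseries q) S (relabel w \<tau>)"
proof -
  have wnz: "(\<Prod>j\<in>UNIV. w j ^ b j) \<noteq> 0" for b :: "'n expo"
    using w by (simp add: prod_zero_iff)
  have bij: "bij \<tau>" using \<tau> by (metis bijI')
  have deg: "edeg (\<lambda>i. b (\<tau> i)) = edeg b" for b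
    unfolding edeg_def using bij by (rule sum.reindex_bij_betw)
  have "relabel w \<tau> \<in> Ring.ring_hom (qseries q) S"
  proof (rule Ring.ring_hom_memI)
    fix f g :: "'n series"
    show "relabel w \<tau> (f \<otimes>\<^bsub>qseries q\<^esub> g) = relabel w \<tau> f \<otimes>\<^bsub>S\<^esub> relabel w \<tau> g"
    proof
      fix c :: "'n expo"
      have aux: "(\<lambda>i. a (\<sigma> i) + b (\<sigma> i)) = c" if "(\<lambda>i. a i + b i) = (\<lambda>i. c (\<tau> i))" for a b
      proof
        fix i show "a (\<sigma> i) + b (\<sigma> i) = c i"
          using fun_cong[OF that, of "\<sigma> i"] by (simp add: \<tau>)
      qed
      have "relabel w \<tau> (f \<otimes>\<^bsub>qseries q\<^esub> g) c =
        (\<Sum>(a, b) | (\<lambda>i. a i + b i) = (\<lambda>i. c (\<tau> i)).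
           (\<Prod>j\<in>UNIV. w j ^ c j) * (q powi qpairing a b * (f a * g b)))"
        by (simp add: relabel_def mult_qseries sum_distrib_left case_prod_beta)
      also have "\<dots> = (\<Sum>(a, b) | (\<lambda>i. a i + b i) = c.
           (\<Prod>j\<in>UNIV. w j ^ c j) * (q powi qpairing (\<lambda>i. a (\<tau> i)) (\<lambda>i. b (\<tau> i)) *
              (f (\<lambda>i. a (\<tau> i)) * g (\<lambda>i. b (\<tau> i)))))"
        by (rule sum.reindex_bij_witness[where
              i = "\<lambda>(a, b). (\<lambda>i. a (\<tau> i), \<lambda>i. b (\<tau> i))" and
              j = "\<lambda>(a, b). (\<lambda>i. a (\<sigma> i), \<lambda>i. b (\<sigma> i))"])
           (auto simp: \<tau> aux)
      also have "\<dots> = (relabel w \<tau> f \<otimes>\<^bsub>S\<^esub> relabel w \<tau> g) c"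
        unfolding mult
        by (rule sum.cong)
           (auto simp: relabel_def power_add prod.distrib mult_ac)
      finally show "relabel w \<tau> (f \<otimes>\<^bsub>qseries q\<^esub> g) c = (relabel w \<tau> f \<otimes>\<^bsub>S\<^esub> relabel w \<tau> g) c" .
    qed
  next
    have "(\<lambda>i. b (\<tau> i)) = (\<lambda>i. 0) \<longleftrightarrow> b = (\<lambda>i. 0)" for b :: "'n expo"
      using \<tau> by (metis (full_types))
    then show "relabel w \<tau> \<one>\<^bsub>qseries q\<^esub> = \<one>\<^bsub>S\<^esub>"
      unfolding S by (auto simp: relabel_def)
  qed (auto simp: S relabel_def algebra_simps)
  moreover have "bij (relabel w \<tau>)"
  proof (rule bijI')
    fix f g :: "'n series"
    show "(relabel w \<tau> f = relabel w \<tau> g) = (f = g)"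
    proof
      assume *: "relabel w \<tau> f = relabel w \<tau> g"
      show "f = g"
      proof
        fix a
        show "f a = g a"
          using fun_cong[OF *, of "\<lambda>i. a (\<sigma> i)"] wnz[of "\<lambda>i. a (\<sigma> i)"] by (simp add: relabel_def \<tau>)
      qed
    qed simp
  next
    fix g :: "'n series"
    have "g = relabel w \<tau> (\<lambda>a. g (\<lambda>i. a (\<sigma> i)) / (\<Prod>j\<in>UNIV. w j ^ a (\<sigma> j)))"
      using wnz by (auto simp: relabel_def \<tau>)
    then show "\<exists>f. g = relabel w \<tau> f" by blast
  qed
  moreover have "relabel w \<tau> (smul c f) = smul c (relabel w \<tau> f)" for c f
    by (auto simp: relabel_def smul_def)
  moreover have "\<exists>m. \<forall>f. (\<forall>a. edeg a < m \<longrightarrow> f a = 0) \<longrightarrow> (\<forall>a. edeg a < n \<longrightarrow> relabel w \<tau> f a = 0)" for n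
    by (rule exI[of _ n]) (auto simp: relabel_def deg)
  ultimately show ?thesis by (simp add: alg_iso_def ring_iso_def S)
qed

lemma relabel_xhat:
  fixes \<alpha> :: "'n::nontriv mod_ring \<Rightarrow> complex"
  assumes \<tau>: "\<And>i. \<tau> (\<sigma> i) = i" "\<And>i. \<sigma> (\<tau> i) = i" and \<alpha>: "\<And>i. \<alpha> i \<noteq> 0"
  shows "relabel (\<lambda>j. \<alpha> j / \<alpha> (\<sigma> j)) \<tau> (xhat \<alpha> i) = xhat \<alpha> (\<tau> i)"
proof
  fix b :: "'n expo"
  have iff: "(\<lambda>k. b (\<tau> k)) = unit_expo i \<longleftrightarrow> b = unit_expo (\<tau> i)"
  proof
    assume "(\<lambda>k. b (\<tau> k)) = unit_expo i"
    then have *: "b (\<tau> k) = unit_expo i k" for k by (rule fun_cong)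
    have "b k = unit_expo (\<tau> i) k" for k
      using *[of "\<sigma> k"] \<tau> by (auto simp: unit_expo_def)
    then show "b = unit_expo (\<tau> i)" by blast
  next
    assume "b = unit_expo (\<tau> i)"
    then show "(\<lambda>k. b (\<tau> k)) = unit_expo i" by (auto simp: unit_expo_def fun_eq_iff) (metis \<tau>(2))
  qed
  have "(\<Prod>j\<in>UNIV. (\<alpha> j / \<alpha> (\<sigma> j)) ^ unit_expo (\<tau> i) j) =
      (\<Prod>j\<in>UNIV. if j = \<tau> i then \<alpha> j / \<alpha> (\<sigma> j) else 1)"
    by (rule prod.cong) (auto simp: unit_expo_def)
  also have "\<dots> = \<alpha> (\<tau> i) / \<alpha> i" by (simp add: \<tau>)
  finally show "relabel (\<lambda>j. \<alpha> j / \<alpha> (\<sigma> j)) \<tau> (xhat \<alpha> i) b = xhat \<alpha> (\<tau> i) b"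
    using \<alpha>[of i] by (auto simp: relabel_def xhat_def iff)
qed

lemma qpairing_shift: "qpairing (\<lambda>i. a (i + 1)) (\<lambda>i. b (i + 1)) = qpairing a b"
  unfolding qpairing_def
  by (rule sum.reindex_bij_witness[where i = "\<lambda>i. i - 1" and j = "\<lambda>i. i + 1"]) auto

lemma qpairing_reflect: "qpairing (\<lambda>i. a (- i)) (\<lambda>i. b (- i)) = qpairing b a"
proof -
  have "qpairing (\<lambda>i. a (- i)) (\<lambda>i. b (- i)) = (\<Sum>i\<in>UNIV. int (a i) * (int (b i) - int (b (i + 1))))"
    unfolding qpairing_def
    by (rule sum.reindex_bij_witness[where i = uminus and j = uminus]) auto
  also have "\<dots> = (\<Sum>i\<in>UNIV. int (a i) * int (b i)) - (\<Sum>i\<in>UNIV. int (a i) * int (b (i + 1)))"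
    by (simp add: right_diff_distrib sum_subtractf)
  also have "(\<Sum>i\<in>UNIV. int (a i) * int (b (i + 1))) = (\<Sum>i\<in>UNIV. int (b i) * int (a (i - 1)))"
    by (rule sum.reindex_bij_witness[where i = "\<lambda>i. i - 1" and j = "\<lambda>i. i + 1"]) auto
  finally show ?thesis
    by (simp add: qpairing_def right_diff_distrib sum_subtractf mult.commute)
qed

lemma dynkin_pi_ex1:
  fixes \<alpha> :: "'n::nontriv mod_ring \<Rightarrow> complex"
  assumes "q \<noteq> 0" "\<And>i. \<alpha> i \<noteq> 0"
  shows "\<exists>!\<phi>. alg_iso (qseries q) (qseries q) \<phi> \<and> (\<forall>i. \<phi> (xhat \<alpha> i) = xhat \<alpha> (i + 1))"
proof (rule ex_ex1I)
  have "alg_iso (qseries q) (qseries q) (relabel (\<lambda>j. \<alpha> j / \<alpha> (j - 1)) (\<lambda>i. i + 1))"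
    by (rule relabel_alg_iso[where \<sigma> = "\<lambda>i. i - 1"])
       (use assms in \<open>auto simp: mult_qseries qpairing_shift\<close>)
  then show "\<exists>\<phi>. alg_iso (qseries q) (qseries q) \<phi> \<and> (\<forall>i. \<phi> (xhat \<alpha> i) = xhat \<alpha> (i + 1))"
    using relabel_xhat[of "\<lambda>i. i + 1" "\<lambda>i. i - 1" \<alpha>] assms by auto
next
  fix \<phi> \<psi>
  assume "alg_iso (qseries q) (qseries q) \<phi> \<and> (\<forall>i. \<phi> (xhat \<alpha> i) = xhat \<alpha> (i + 1))"
    and "alg_iso (qseries q) (qseries q) \<psi> \<and> (\<forall>i. \<psi> (xhat \<alpha> i) = xhat \<alpha> (i + 1))"
  then show "\<phi> = \<psi>" using assms by (intro alg_iso_unique[of q \<alpha> "qseries q"]) auto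
qed

lemma opposite_ring_sel [simp]:
  "carrier (opposite_ring R) = carrier R" "\<one>\<^bsub>opposite_ring R\<^esub> = \<one>\<^bsub>R\<^esub>"
  "x \<oplus>\<^bsub>opposite_ring R\<^esub> y = x \<oplus>\<^bsub>R\<^esub> y" "x \<otimes>\<^bsub>opposite_ring R\<^esub> y = y \<otimes>\<^bsub>R\<^esub> x"
  by (simp_all add: opposite_ring_def)

lemma dynkin_s0_ex1:
  fixes \<alpha> :: "'n::nontriv mod_ring \<Rightarrow> complex"
  assumes "q \<noteq> 0" "\<And>i. \<alpha> i \<noteq> 0"
  shows "\<exists>!\<phi>. alg_iso (qseries q) (opposite_ring (qseries q)) \<phi> \<and> (\<forall>i. \<phi> (xhat \<alpha> i) = xhat \<alpha> (- i))"
proof (rule ex_ex1I)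
  have "(f \<otimes>\<^bsub>opposite_ring (qseries q)\<^esub> g) c = (\<Sum>(a, b) | (\<lambda>i. a i + b i) = c.
        q powi qpairing (\<lambda>i. a (- i)) (\<lambda>i. b (- i)) * (f a * g b))" for f g :: "'n series" and c
    unfolding opposite_ring_sel mult_qseries qpairing_reflect
    by (rule sum.reindex_bij_witness[where i = "\<lambda>(a, b). (b, a)" and j = "\<lambda>(a, b). (b, a)"])
       (auto simp: add.commute mult_ac)
  then have "alg_iso (qseries q) (opposite_ring (qseries q)) (relabel (\<lambda>j. \<alpha> j / \<alpha> (- j)) (\<lambda>i. - i))"
    by (intro relabel_alg_iso[where \<sigma> = "\<lambda>i. - i"]) (use assms in auto)
  then show "\<exists>\<phi>. alg_iso (qseries q) (opposite_ring (qseries q)) \<phi> \<and> (\<forall>i. \<phi> (xhat \<alpha> i) = xhat \<alpha> (- i))"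
    using relabel_xhat[of "\<lambda>i. - i" "\<lambda>i. - i" \<alpha>] assms by auto
next
  fix \<phi> \<psi>
  assume "alg_iso (qseries q) (opposite_ring (qseries q)) \<phi> \<and> (\<forall>i. \<phi> (xhat \<alpha> i) = xhat \<alpha> (- i))"
    and "alg_iso (qseries q) (opposite_ring (qseries q)) \<psi> \<and> (\<forall>i. \<psi> (xhat \<alpha> i) = xhat \<alpha> (- i))"
  then show "\<phi> = \<psi>" using assms by (intro alg_iso_unique[of q \<alpha> "opposite_ring (qseries q)"]) auto
qed

end

(*
  With E(z) = e_q(-z), everything rests on the pentagon identity E(v) E(u) = E(u) E(u v) E(v) for
  v u = q u v, and on the commutation of E(u) and E(v) when u v = v u.  Put D_m(p) =
  E(x_p) E(x_p x_(p-1)) ... E(x_p ... x_(p-m+1)).  Moving E(x_i) to the right through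
  E(x_(i+1)) ... E(x_(i+N-2)) turns A into the lower product B_i.  Moving E(x_(i+N-1)) to the left
  through the same factors produces D_(N-1)(i-1), and turns A into the upper product B^(i-1).
  Finally, moving E(x_(p+1)) to the left through D_(N-1)(p) produces D_(N-1)(p+1), which gives
  B^p = B^(p+1).  Since pi maps B_i to B_(i+1) and s_0 maps B_i to B^(-i), invariance follows.
*)
theory Submission
  imports Defs
begin

subsection \<open>Truncation by degree\<close>

text \<open>Equality of completed series reduces to finite algebra: below a given degree a
  q-exponential is a polynomial in its argument, and a product only sees its factors below that
  degree. Since x_i x_(i+1) = q x_(i+1) x_i, the pentagon forces v = x_i, u = x_(i+1). Every swap
  therefore creates a descending string x_a x_(a-1) ... x_b, and extending a string at its top or
  bottom is again a pentagon. A generator strictly inside a string, or next to both of its ends,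
  commutes with it, because a factor q meets a factor q^(-1). The second case closes the cycle: a
  string of N-1 generators commutes with the missing one, so strings stop growing. The product A
  only gives B_i = B^(i-1), one index off the claim, hence the separate proof of B^p = B^(p+1).
  After D_(N-1)(p+1) has been split off there, the rest D_(N-1)(p) E(x_(p+2)) ... E(x_(p+N-1)) is
  folded back into E(x_(p+2)) ... E(x_(p+N)) by the rule that rewrites A into the upper
  product.\<close>

declare qseries_sel(2-4) [simp del]

lemma edeg_add: "edeg (\<lambda>i. a i + b i) = edeg a + edeg b"
  by (simp add: edeg_def sum.distrib)

lemma edeg_eq_0_iff: "edeg a = 0 \<longleftrightarrow> a = (\<lambda>i. 0)"
  by (auto simp: edeg_def fun_eq_iff)

text \<open>Congruence modulo the series that start in degree \<open>D\<close>; it takes the place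
  of a topology on the completed algebra.\<close>

definition agree :: "nat \<Rightarrow> 'n::nontriv series \<Rightarrow> 'n series \<Rightarrow> bool" where
  "agree D f g \<longleftrightarrow> (\<forall>a. edeg a < D \<longrightarrow> f a = g a)"

lemma agree_refl: "agree D f f"
  and agree_trans: "agree D f g \<Longrightarrow> agree D g h \<Longrightarrow> agree D f h"
  by (simp_all add: agree_def)

lemma agree_imp_eq:
  assumes "\<And>D. agree D f g"
  shows "f = g"
proof
  fix a show "f a = g a" using assms[of "Suc (edeg a)"] by (simp add: agree_def)
qed

text \<open>Degrees add up in a splitting of an exponent, so both parts stay below \<open>D\<close>.
  Hence factors may be truncated before they are multiplied.\<close>

lemma agree_mult:
  assumes "agree D f f'" "agree D g g'"
  shows "agree D (f \<otimes>\<^bsub>qseries q\<^esub> g) (f' \<otimes>\<^bsub>qseries q\<^esub> g')"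
  unfolding agree_def
proof (intro allI impI)
  fix c :: "'a expo" assume "edeg c < D"
  then show "(f \<otimes>\<^bsub>qseries q\<^esub> g) c = (f' \<otimes>\<^bsub>qseries q\<^esub> g') c"
    unfolding mult_qseries using assms
    by (intro sum.cong) (auto simp: edeg_add agree_def)
qed

definition no_const :: "'n::nontriv series \<Rightarrow> bool" where
  "no_const f \<longleftrightarrow> f (\<lambda>i. 0) = 0"

lemma mult_vanish:
  assumes "\<And>a. edeg a < k \<Longrightarrow> f a = 0" "\<And>a. edeg a < l \<Longrightarrow> g a = 0" "edeg c < k + l"
  shows "(f \<otimes>\<^bsub>qseries q\<^esub> g) c = 0"
  unfolding mult_qseries
proof (rule sum.neutral, clarify)
  fix a b :: "'a expo" assume "c = (\<lambda>i. a i + b i)"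
  then have "edeg a < k \<or> edeg b < l" using assms(3) by (auto simp: edeg_add)
  then show "q powi qpairing a b * (f a * g b) = 0" using assms by auto
qed

lemma pow_vanish:
  assumes "no_const z" "edeg a < n"
  shows "(z [^]\<^bsub>qseries q\<^esub> n) a = 0"
  using assms(2)
proof (induction n arbitrary: a)
  case (Suc n)
  have "z b = 0" if "edeg b < 1" for b
    using assms(1) that edeg_eq_0_iff[of b] by (simp add: no_const_def)
  then show ?case
    using Suc mult_vanish[of n "z [^]\<^bsub>qseries q\<^esub> n" 1 z a] by simp
qed simp

lemma no_const_mult:
  assumes "no_const f"
  shows "no_const (f \<otimes>\<^bsub>qseries q\<^esub> g)"
  using assms mult_vanish[of 1 f 0 g "\<lambda>i. 0" q] by (simp add: no_const_def edeg_eq_0_iff)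

lemma no_const_xhat: "no_const (xhat \<alpha> i)"
  by (auto simp: no_const_def xhat_def unit_expo_def fun_eq_iff)

lemma sum_mult_left:
  "(\<lambda>a. \<Sum>n\<in>A. c n * F n a) \<otimes>\<^bsub>qseries q\<^esub> g = (\<lambda>a. \<Sum>n\<in>A. c n * (F n \<otimes>\<^bsub>qseries q\<^esub> g) a)"
proof
  fix a
  show "((\<lambda>a. \<Sum>n\<in>A. c n * F n a) \<otimes>\<^bsub>qseries q\<^esub> g) a = (\<Sum>n\<in>A. c n * (F n \<otimes>\<^bsub>qseries q\<^esub> g) a)"
    unfolding mult_qseries sum_distrib_left sum_distrib_right case_prod_beta
    by (subst sum.swap) (simp add: mult_ac)
qed

lemma sum_mult_right:
  "g \<otimes>\<^bsub>qseries q\<^esub> (\<lambda>a. \<Sum>n\<in>A. c n * F n a) = (\<lambda>a. \<Sum>n\<in>A. c n * (g \<otimes>\<^bsub>qseries q\<^esub> F n) a)"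
proof
  fix a
  show "(g \<otimes>\<^bsub>qseries q\<^esub> (\<lambda>a. \<Sum>n\<in>A. c n * F n a)) a = (\<Sum>n\<in>A. c n * (g \<otimes>\<^bsub>qseries q\<^esub> F n) a)"
    unfolding mult_qseries sum_distrib_left sum_distrib_right case_prod_beta
    by (subst sum.swap) (simp add: mult_ac)
qed

lemma smul_smul: "smul c (smul d f) = smul (c * d) f"
  by (simp add: smul_def mult_ac)

lemma smul_one: "smul 1 f = f"
  by (simp add: smul_def)

lemma smul_pow: "smul c f [^]\<^bsub>qseries q\<^esub> n = smul (c ^ n) (f [^]\<^bsub>qseries q\<^esub> (n::nat))"
  by (induction n) (simp_all add: smul_one smul_mult smul_smul mult_ac)

section \<open>The q-exponential: coefficients, truncation, invertibility, commutation\<close>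

definition eneg_coeff :: "complex \<Rightarrow> nat \<Rightarrow> complex" where
  "eneg_coeff q n = (-1) ^ n / qpoch q n"

lemma eneg_coeff_0 [simp]: "eneg_coeff q 0 = 1"
  by (simp add: eneg_coeff_def qpoch_def)

lemma one_minus_power_nonzero: "norm q < 1 \<Longrightarrow> 1 - q ^ Suc n \<noteq> (0::complex)"
  by (metis norm_one norm_power norm_ge_zero order_less_irrefl right_minus_eq
      power_one zero_less_Suc power_strict_mono)

text \<open>Coefficient form of E(q z) = (1 + z) E(z) for E(z) = e_q(-z); the bound on
  \<open>q\<close> keeps 1 - q^(n+1) nonzero.\<close>

lemma eneg_coeff_Suc:
  assumes "norm q < 1"
  shows "(1 - q ^ Suc n) * eneg_coeff q (Suc n) = - eneg_coeff q n"
  using one_minus_power_nonzero[OF assms, of n]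
  by (simp add: eneg_coeff_def qpoch_def divide_simps)

text \<open>The truncation order \<open>m\<close> may exceed \<open>D\<close>, since transport along
  an isomorphism needs one truncation that serves two degree bounds.\<close>

lemma agree_eneg:
  assumes "q \<noteq> 0" "no_const z" "D \<le> m"
  shows "agree D (eneg q z) (\<lambda>a. \<Sum>n<m. eneg_coeff q n * (z [^]\<^bsub>qseries q\<^esub> n) a)"
  unfolding agree_def
proof (intro allI impI)
  fix a :: "'a expo" assume a: "edeg a < D"
  have "\<ominus>\<^bsub>qseries q\<^esub> z = smul (-1) z"
    by (simp add: neg_qseries[OF assms(1)] smul_def)
  then have "eneg q z a = (\<Sum>n. eneg_coeff q n * (z [^]\<^bsub>qseries q\<^esub> n) a)"
    by (simp add: eneg_def qexp_def smul_pow eneg_coeff_def) (simp add: smul_def)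
  also have "\<dots> = (\<Sum>n<m. eneg_coeff q n * (z [^]\<^bsub>qseries q\<^esub> n) a)"
    by (rule suminf_finite) (use a assms in \<open>auto simp: pow_vanish\<close>)
  finally show "eneg q z a = (\<Sum>n<m. eneg_coeff q n * (z [^]\<^bsub>qseries q\<^esub> n) a)" .
qed

lemma eneg_const:
  assumes "q \<noteq> 0" "no_const z"
  shows "eneg q z (\<lambda>i. 0) = 1"
  using agree_eneg[OF assms le_refl, of 1]
  by (simp add: agree_def qseries_sel(2)) (metis edeg_eq_0_iff)

text \<open>Geometric series in \<open>h = 1 - f\<close>: as h^n starts in degree n, the coefficient
  at \<open>a\<close> only involves powers up to \<open>edeg a\<close>, and the truncations
  telescope on both sides.\<close>

lemma unit_if_const_1:
  assumes q: "q \<noteq> 0" and f: "f (\<lambda>i. 0) = 1"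
  shows "f \<in> Units (qseries q)"
proof -
  interpret ring "qseries q :: 'a series ring" by (rule ring_qseries[OF q])
  let ?one = "\<one>\<^bsub>qseries q\<^esub> :: 'a series"
  define h where "h = (\<lambda>a. ?one a - f a)"
  have h: "no_const h" using f by (simp add: h_def no_const_def qseries_sel(2))
  define g where "g = (\<lambda>a. \<Sum>n\<le>edeg a. (h [^]\<^bsub>qseries q\<^esub> n) a)"
  define t where "t D = (\<lambda>a. \<Sum>n<D. 1 * (h [^]\<^bsub>qseries q\<^esub> n) a)" for D :: nat
  have g: "agree D g (t D)" for D
    unfolding agree_def g_def t_def
    by (auto intro!: sum.mono_neutral_left) (metis linorder_not_le pow_vanish[OF h])
  \<comment> \<open>\<open>1 - h\<close> as a two-term sum, so that the expansion rules for finite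
    sums apply to it.\<close>
  have f_eq: "f = (\<lambda>a. \<Sum>n\<in>{0,1::nat}. (if n = 0 then 1 else -1) * (if n = 0 then ?one else h) a)"
    by (auto simp: h_def)
  have tel: "(\<Sum>n<D. (h [^]\<^bsub>qseries q\<^esub> n) a - (h [^]\<^bsub>qseries q\<^esub> Suc n) a) = ?one a"
    if "edeg a < D" for a D
  proof -
    have "(\<Sum>n<D. (h [^]\<^bsub>qseries q\<^esub> n) a - (h [^]\<^bsub>qseries q\<^esub> Suc n) a)
        = (h [^]\<^bsub>qseries q\<^esub> (0::nat)) a - (h [^]\<^bsub>qseries q\<^esub> D) a"
      by (rule sum_lessThan_telescope')
    then show ?thesis using pow_vanish[OF h that] by simp
  qed
  have "t D \<otimes>\<^bsub>qseries q\<^esub> f = (\<lambda>a. \<Sum>n<D. (h [^]\<^bsub>qseries q\<^esub> n) a - (h [^]\<^bsub>qseries q\<^esub> Suc n) a)" for D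
    unfolding t_def sum_mult_left
    by (subst f_eq, subst sum_mult_right) (simp add: mult_qseries_one)
  then have "agree D (t D \<otimes>\<^bsub>qseries q\<^esub> f) ?one" for D
    using tel by (simp add: agree_def)
  then have "g \<otimes>\<^bsub>qseries q\<^esub> f = ?one"
    by (intro agree_imp_eq) (rule agree_trans[OF agree_mult[OF g agree_refl]])
  moreover have "f \<otimes>\<^bsub>qseries q\<^esub> t D = (\<lambda>a. \<Sum>n<D. (h [^]\<^bsub>qseries q\<^esub> n) a - (h [^]\<^bsub>qseries q\<^esub> Suc n) a)" for D
    unfolding t_def sum_mult_right
    by (subst f_eq, subst sum_mult_left)
      (use nat_pow_Suc2[of h] in \<open>simp add: one_mult_qseries\<close>)
  then have "agree D (f \<otimes>\<^bsub>qseries q\<^esub> t D) ?one" for D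
    using tel by (simp add: agree_def)
  then have "f \<otimes>\<^bsub>qseries q\<^esub> g = ?one"
    by (intro agree_imp_eq) (rule agree_trans[OF agree_mult[OF agree_refl g]])
  ultimately show ?thesis by (auto simp: Units_def)
qed

lemma commute_eneg:
  assumes q: "q \<noteq> 0" and z: "no_const z"
    and com: "f \<otimes>\<^bsub>qseries q\<^esub> z = z \<otimes>\<^bsub>qseries q\<^esub> f"
  shows "f \<otimes>\<^bsub>qseries q\<^esub> eneg q z = eneg q z \<otimes>\<^bsub>qseries q\<^esub> f"
proof -
  interpret ring "qseries q :: 'a series ring" by (rule ring_qseries[OF q])
  have pow: "f \<otimes>\<^bsub>qseries q\<^esub> z [^]\<^bsub>qseries q\<^esub> n = z [^]\<^bsub>qseries q\<^esub> n \<otimes>\<^bsub>qseries q\<^esub> f" for n :: nat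
  proof (induction n)
    case (Suc n)
    then have "f \<otimes>\<^bsub>qseries q\<^esub> (z [^]\<^bsub>qseries q\<^esub> n \<otimes>\<^bsub>qseries q\<^esub> z)
        = z [^]\<^bsub>qseries q\<^esub> n \<otimes>\<^bsub>qseries q\<^esub> (f \<otimes>\<^bsub>qseries q\<^esub> z)"
      by (simp add: mult_qseries_assoc[OF q, symmetric])
    then show ?case by (simp add: com mult_qseries_assoc[OF q])
  qed (simp add: one_mult_qseries mult_qseries_one)
  show ?thesis
  proof (rule agree_imp_eq)
    fix D
    let ?t = "\<lambda>a. \<Sum>n<D. eneg_coeff q n * (z [^]\<^bsub>qseries q\<^esub> n) a"
    have "f \<otimes>\<^bsub>qseries q\<^esub> ?t = ?t \<otimes>\<^bsub>qseries q\<^esub> f"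
      by (simp add: sum_mult_left sum_mult_right pow)
    moreover have "agree D (f \<otimes>\<^bsub>qseries q\<^esub> eneg q z) (f \<otimes>\<^bsub>qseries q\<^esub> ?t)"
      by (rule agree_mult[OF agree_refl agree_eneg[OF q z le_refl]])
    moreover have "agree D (eneg q z \<otimes>\<^bsub>qseries q\<^esub> f) (?t \<otimes>\<^bsub>qseries q\<^esub> f)"
      by (rule agree_mult[OF agree_eneg[OF q z le_refl] agree_refl])
    ultimately show "agree D (f \<otimes>\<^bsub>qseries q\<^esub> eneg q z) (eneg q z \<otimes>\<^bsub>qseries q\<^esub> f)"
      by (simp add: agree_def)
  qed
qed

lemma eneg_commute:
  assumes "q \<noteq> 0" "no_const u" "no_const v"
    and "u \<otimes>\<^bsub>qseries q\<^esub> v = v \<otimes>\<^bsub>qseries q\<^esub> u"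
  shows "eneg q u \<otimes>\<^bsub>qseries q\<^esub> eneg q v = eneg q v \<otimes>\<^bsub>qseries q\<^esub> eneg q u"
  using assms(1,3) commute_eneg[OF assms(1,2), of v] assms(4)
  by (intro commute_eneg) simp_all

subsection \<open>The pentagon identity\<close>

text \<open>Terms that the shift pushes to \<open>D\<close> or beyond are zero, so both sums can
  keep the range below \<open>D\<close>.\<close>

lemma sum_shift_truncate:
  fixes f :: "nat \<Rightarrow> 'a::comm_ring_1"
  assumes "\<And>n. n \<ge> D \<Longrightarrow> g n = 0"
  shows "(\<Sum>i<D. f i * g (i + k)) = (\<Sum>n<D. (if k \<le> n then f (n - k) else 0) * g n)"
proof -
  have "(\<Sum>n<D. (if k \<le> n then f (n - k) else 0) * g n) = (\<Sum>n\<in>{k..<D}. f (n - k) * g n)"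
    by (rule sum.mono_neutral_cong_right) auto
  also have "\<dots> = (\<Sum>i<D - k. f i * g (i + k))"
    by (rule sum.reindex_bij_witness[where i = "\<lambda>i. i + k" and j = "\<lambda>n. n - k"]) auto
  also have "\<dots> = (\<Sum>i<D. f i * g (i + k))"
    by (rule sum.mono_neutral_left) (auto simp: assms)
  finally show ?thesis by simp
qed

text \<open>The cutoff is explicit because natural subtraction would give
  \<open>eneg_coeff q 0 = 1\<close> for \<open>k > n\<close>; with zero there, sums over different
  \<open>k\<close> can share one range.\<close>

definition eneg_coeff_diff :: "complex \<Rightarrow> nat \<Rightarrow> nat \<Rightarrow> complex" where
  "eneg_coeff_diff q n k = (if k \<le> n then eneg_coeff q (n - k) else 0)"

lemma one_minus_power_mult_eneg_coeff:
  assumes "norm q < 1"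
  shows "(1 - q ^ n) * eneg_coeff q n = (if n = 0 then 0 else - eneg_coeff q (n - 1))"
  using eneg_coeff_Suc[OF assms, of "n - 1"] by (cases n) auto

text \<open>The coefficient of \<open>u\<^sup>n v\<^sup>m\<close> in the pentagon identity; \<open>k\<close> is the exponent of \<open>u v\<close> in the middle factor.\<close>

lemma pentagon_coeff:
  assumes q: "norm q < 1"
  shows "(\<Sum>k\<le>n. q ^ (k choose 2) * eneg_coeff q k * eneg_coeff_diff q n k * eneg_coeff_diff q m k)
    = q ^ (n * m) * eneg_coeff q n * eneg_coeff q m"
    (is "?S n m = _")
proof (induction n arbitrary: m)
  case 0
  show ?case by (simp add: eneg_coeff_diff_def binomial_eq_0)
next
  case (Suc n)
  let ?c = "eneg_coeff q" and ?d = "eneg_coeff_diff q"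
  \<comment> \<open>1 - q^(n+1) = (1 - q^(n+1-k)) + q^(n+1-k) (1 - q^k), and the recursion of the
    coefficients absorbs the first part into c_(n+1-k), the second into c_k.\<close>
  have split: "(1 - q ^ Suc n) * (?c k * ?d (Suc n) k) =
      - (?c k * ?d n k) + (if k = 0 then 0 else - (q ^ (Suc n - k) * ?c (k - 1) * ?d (Suc n) k))"
    if "k \<le> Suc n" for k
  proof -
    have "1 - q ^ Suc n = (1 - q ^ (Suc n - k)) + q ^ (Suc n - k) * (1 - q ^ k)"
      using that by (simp add: algebra_simps flip: power_add)
    then have "(1 - q ^ Suc n) * (?c k * ?d (Suc n) k) =
        ?c k * ((1 - q ^ (Suc n - k)) * ?d (Suc n) k) + q ^ (Suc n - k) * ((1 - q ^ k) * ?c k) * ?d (Suc n) k"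
      by (simp only: distrib_right) (simp only: mult_ac)
    also have "(1 - q ^ (Suc n - k)) * ?d (Suc n) k = - ?d n k"
    proof -
      have "(1 - q ^ (Suc n - k)) * ?d (Suc n) k = (1 - q ^ (Suc n - k)) * ?c (Suc n - k)"
        using that by (simp add: eneg_coeff_diff_def)
      also have "\<dots> = - ?d n k"
        unfolding one_minus_power_mult_eneg_coeff[OF q]
        using that by (auto simp: eneg_coeff_diff_def le_Suc_eq Suc_diff_le)
      finally show ?thesis .
    qed
    also note one_minus_power_mult_eneg_coeff[OF q]
    finally show ?thesis by (simp only: split: if_split) simp
  qed
  \<comment> \<open>Replacing k by k + 1 lowers m by one, and (k+1 choose 2) + (n - k) = n + (k
    choose 2) pulls out q^n independently of k.\<close>
  have shift: "(if Suc k = 0 then 0 else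
        - (q ^ (Suc k choose 2) * q ^ (Suc n - Suc k) * ?c (Suc k - 1) * ?d (Suc n) (Suc k) * ?d m (Suc k)))
      = - (q ^ n * (q ^ (k choose 2) * ?c k * ?d n k * (if m = 0 then 0 else ?d (m - 1) k)))"
    if "k \<le> n" for k
  proof -
    have e: "(Suc k choose 2) + (n - k) = n + (k choose 2)"
      using that by (simp add: numeral_2_eq_2)
    have d: "?d (Suc n) (Suc k) = ?d n k" "?d m (Suc k) = (if m = 0 then 0 else ?d (m - 1) k)"
      by (auto simp: eneg_coeff_diff_def)
    have "q ^ (Suc k choose 2) * q ^ (n - k) = q ^ n * q ^ (k choose 2)"
      by (simp only: power_add[symmetric] e)
    then show ?thesis unfolding d by simp
  qed
  have "(1 - q ^ Suc n) * ?S (Suc n) m =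
      (\<Sum>k\<le>Suc n. q ^ (k choose 2) * ((1 - q ^ Suc n) * (?c k * ?d (Suc n) k)) * ?d m k)"
    by (simp only: sum_distrib_left mult_ac)
  also have "\<dots> = (\<Sum>k\<le>Suc n. - (q ^ (k choose 2) * ?c k * ?d n k * ?d m k))
      + (\<Sum>k\<le>Suc n. if k = 0 then 0 else
           - (q ^ (k choose 2) * q ^ (Suc n - k) * ?c (k - 1) * ?d (Suc n) k * ?d m k))"
    unfolding sum.distrib[symmetric]
  proof (rule sum.cong[OF refl])
    fix k assume "k \<in> {..Suc n}"
    then have "k \<le> Suc n" by simp
    then show "q ^ (k choose 2) * ((1 - q ^ Suc n) * (?c k * ?d (Suc n) k)) * ?d m k =
        - (q ^ (k choose 2) * ?c k * ?d n k * ?d m k) + (if k = 0 then 0 else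
           - (q ^ (k choose 2) * q ^ (Suc n - k) * ?c (k - 1) * ?d (Suc n) k * ?d m k))"
      by (simp only: split) (simp add: algebra_simps)
  qed
  also have "(\<Sum>k\<le>Suc n. - (q ^ (k choose 2) * ?c k * ?d n k * ?d m k)) = - ?S n m"
    by (simp add: eneg_coeff_diff_def sum_negf)
  also have "(\<Sum>k\<le>Suc n. if k = 0 then 0 else
           - (q ^ (k choose 2) * q ^ (Suc n - k) * ?c (k - 1) * ?d (Suc n) k * ?d m k))
      = (\<Sum>k\<le>n. - (q ^ n * (q ^ (k choose 2) * ?c k * ?d n k * (if m = 0 then 0 else ?d (m - 1) k))))"
    by (simp only: sum.atMost_Suc_shift simp_thms if_True add_0, rule sum.cong[OF refl shift]) simp
  also have "\<dots> = - (q ^ n * (if m = 0 then 0 else ?S n (m - 1)))"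
    by (auto simp: sum_negf sum_distrib_left)
  also have "- ?S n m + \<dots> = - ?c n * q ^ (n * m) * (?c m + (if m = 0 then 0 else ?c (m - 1)))"
    unfolding Suc.IH by (cases m) (auto simp: algebra_simps power_add)
  \<comment> \<open>The recursion once more, now in m; it supplies the missing power q^m.\<close>
  also have "?c m + (if m = 0 then 0 else ?c (m - 1)) = q ^ m * ?c m"
    using one_minus_power_mult_eneg_coeff[OF q, of m] by (auto simp: algebra_simps split: if_splits)
  also have "- ?c n = (1 - q ^ Suc n) * ?c (Suc n)"
    by (simp only: eneg_coeff_Suc[OF q])
  also have "(1 - q ^ Suc n) * ?c (Suc n) * q ^ (n * m) * (q ^ m * ?c m)
      = (1 - q ^ Suc n) * (q ^ (Suc n * m) * ?c (Suc n) * ?c m)"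
    by (simp add: power_add mult_ac)
  finally show ?case
    using one_minus_power_nonzero[OF q, of n] by (simp only: mult_cancel_left) simp
qed

lemma q_commute_pow:
  assumes q: "q \<noteq> 0"
    and com: "v \<otimes>\<^bsub>qseries q\<^esub> u = smul q (u \<otimes>\<^bsub>qseries q\<^esub> v)"
  shows "v [^]\<^bsub>qseries q\<^esub> m \<otimes>\<^bsub>qseries q\<^esub> u [^]\<^bsub>qseries q\<^esub> n
    = smul (q ^ (n * m)) (u [^]\<^bsub>qseries q\<^esub> n \<otimes>\<^bsub>qseries q\<^esub> v [^]\<^bsub>qseries q\<^esub> (m::nat))"
proof -
  have 1: "v \<otimes>\<^bsub>qseries q\<^esub> u [^]\<^bsub>qseries q\<^esub> n = smul (q ^ n) (u [^]\<^bsub>qseries q\<^esub> n \<otimes>\<^bsub>qseries q\<^esub> v)"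
    for n :: nat
  proof (induction n)
    case (Suc n)
    have "v \<otimes>\<^bsub>qseries q\<^esub> (u [^]\<^bsub>qseries q\<^esub> n \<otimes>\<^bsub>qseries q\<^esub> u)
        = smul (q ^ n) (u [^]\<^bsub>qseries q\<^esub> n \<otimes>\<^bsub>qseries q\<^esub> (v \<otimes>\<^bsub>qseries q\<^esub> u))"
      by (simp add: mult_qseries_assoc[OF q, symmetric] Suc smul_mult)
    then show ?case by (simp add: com mult_qseries_assoc[OF q] smul_mult smul_smul mult_ac)
  qed (simp add: one_mult_qseries mult_qseries_one smul_one)
  show ?thesis
  proof (induction m)
    case (Suc m)
    have "v [^]\<^bsub>qseries q\<^esub> m \<otimes>\<^bsub>qseries q\<^esub> v \<otimes>\<^bsub>qseries q\<^esub> u [^]\<^bsub>qseries q\<^esub> n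
        = smul (q ^ n) (v [^]\<^bsub>qseries q\<^esub> m \<otimes>\<^bsub>qseries q\<^esub> u [^]\<^bsub>qseries q\<^esub> n \<otimes>\<^bsub>qseries q\<^esub> v)"
      by (simp add: mult_qseries_assoc[OF q] 1 smul_mult)
    then show ?case by (simp add: Suc mult_qseries_assoc[OF q] smul_mult smul_smul power_add)
  qed (simp add: one_mult_qseries mult_qseries_one smul_one)
qed

text \<open>Sorting (u v)^n moves each v past all u to its right: 0 + 1 + ... + (n-1) swaps, each
  contributing q.\<close>

lemma q_commute_mult_pow:
  assumes q: "q \<noteq> 0"
    and com: "v \<otimes>\<^bsub>qseries q\<^esub> u = smul q (u \<otimes>\<^bsub>qseries q\<^esub> v)"
  shows "(u \<otimes>\<^bsub>qseries q\<^esub> v) [^]\<^bsub>qseries q\<^esub> n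
    = smul (q ^ (n choose 2)) (u [^]\<^bsub>qseries q\<^esub> n \<otimes>\<^bsub>qseries q\<^esub> v [^]\<^bsub>qseries q\<^esub> n)"
proof (induction n)
  case (Suc n)
  note assoc = mult_qseries_assoc[OF q]
  have "v [^]\<^bsub>qseries q\<^esub> n \<otimes>\<^bsub>qseries q\<^esub> (u \<otimes>\<^bsub>qseries q\<^esub> v)
      = smul (q ^ n) (u \<otimes>\<^bsub>qseries q\<^esub> (v [^]\<^bsub>qseries q\<^esub> n \<otimes>\<^bsub>qseries q\<^esub> v))"
    using q_commute_pow[OF assms, of n 1]
    by (simp add: assoc[symmetric] one_mult_qseries smul_mult)
  then show ?case
    by (simp add: Suc smul_mult smul_smul assoc numeral_2_eq_2 power_add mult_ac)
qed (simp add: one_mult_qseries smul_one binomial_eq_0)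

text \<open>Modulo degree \<open>D\<close> both sides are sorted into monomials u^n v^m. The left
  coefficient is q^(n m) c_n c_m; on the right u^i (u v)^k v^j contributes to n = i + k, m = j + k,
  and \<open>pentagon_coeff\<close> matches the two.\<close>

lemma pentagon:
  fixes u v :: "'n::nontriv series"
  assumes q: "q \<noteq> 0" "norm q < 1" and uv: "no_const u" "no_const v"
    and com: "v \<otimes>\<^bsub>qseries q\<^esub> u = smul q (u \<otimes>\<^bsub>qseries q\<^esub> v)"
  shows "eneg q v \<otimes>\<^bsub>qseries q\<^esub> eneg q u
    = eneg q u \<otimes>\<^bsub>qseries q\<^esub> (eneg q (u \<otimes>\<^bsub>qseries q\<^esub> v) \<otimes>\<^bsub>qseries q\<^esub> eneg q v)"
proof (rule agree_imp_eq)
  fix D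
  interpret ring "qseries q :: 'n series ring" by (rule ring_qseries[OF q(1)])
  note assoc = mult_qseries_assoc[OF q(1)]
  let ?c = "eneg_coeff q" and ?d = "eneg_coeff_diff q"
  define W where "W n m = u [^]\<^bsub>qseries q\<^esub> n \<otimes>\<^bsub>qseries q\<^esub> v [^]\<^bsub>qseries q\<^esub> m" for n m :: nat
  \<comment> \<open>u^n v^m starts in degree n + m at least, so index shifts never leave the range
    below \<open>D\<close>.\<close>
  have W0: "W n m a = 0" if "edeg a < D" "n \<ge> D \<or> m \<ge> D" for n m a
    unfolding W_def by (rule mult_vanish[of n _ m]) (use that uv in \<open>auto simp: pow_vanish\<close>)
  define E where "E z = (\<lambda>a. \<Sum>n<D. ?c n * (z [^]\<^bsub>qseries q\<^esub> n) a)" for z :: "'n series"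
  have E: "agree D (eneg q z) (E z)" if "no_const z" for z
    unfolding E_def by (rule agree_eneg[OF q(1) that le_refl])
  have L: "(E v \<otimes>\<^bsub>qseries q\<^esub> E u) a = (\<Sum>n<D. \<Sum>m<D. q ^ (n * m) * ?c n * ?c m * W n m a)" for a
    unfolding E_def sum_mult_left sum_mult_right q_commute_pow[OF q(1) com] sum_distrib_left
    by (subst sum.swap) (simp add: W_def smul_def mult_ac)
  have W3: "u [^]\<^bsub>qseries q\<^esub> i \<otimes>\<^bsub>qseries q\<^esub> ((u \<otimes>\<^bsub>qseries q\<^esub> v) [^]\<^bsub>qseries q\<^esub> k \<otimes>\<^bsub>qseries q\<^esub> v [^]\<^bsub>qseries q\<^esub> j)
      = smul (q ^ (k choose 2)) (W (i + k) (j + k))" for i j k :: nat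
  proof -
    have "W (i + k) (j + k) = u [^]\<^bsub>qseries q\<^esub> i \<otimes>\<^bsub>qseries q\<^esub> (u [^]\<^bsub>qseries q\<^esub> k \<otimes>\<^bsub>qseries q\<^esub> (v [^]\<^bsub>qseries q\<^esub> k \<otimes>\<^bsub>qseries q\<^esub> v [^]\<^bsub>qseries q\<^esub> j))"
      by (simp add: W_def nat_pow_mult assoc[symmetric])
        (simp add: assoc nat_pow_mult add.commute)
    then show ?thesis
      by (simp add: q_commute_mult_pow[OF q(1) com] smul_mult assoc)
  qed
  have R: "(E u \<otimes>\<^bsub>qseries q\<^esub> (E (u \<otimes>\<^bsub>qseries q\<^esub> v) \<otimes>\<^bsub>qseries q\<^esub> E v)) a
      = (\<Sum>n<D. \<Sum>m<D. q ^ (n * m) * ?c n * ?c m * W n m a)" if a: "edeg a < D" for a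
  proof -
    have shift: "(\<Sum>i<D. ?c i * (\<Sum>j<D. ?c j * W (i + k) (j + k) a)) = (\<Sum>n<D. ?d n k * (\<Sum>m<D. ?d m k * W n m a))"
      for k
    proof -
      have "(\<Sum>j<D. ?c j * W n (j + k) a) = (\<Sum>m<D. ?d m k * W n m a)" for n
        unfolding eneg_coeff_diff_def by (rule sum_shift_truncate) (use W0 a in auto)
      moreover have "(\<Sum>i<D. ?c i * (\<Sum>m<D. ?d m k * W (i + k) m a)) = (\<Sum>n<D. ?d n k * (\<Sum>m<D. ?d m k * W n m a))"
        unfolding eneg_coeff_diff_def[of q _ k]
        by (rule sum_shift_truncate) (use W0 a in auto)
      ultimately show ?thesis by simp
    qed
    have "(E u \<otimes>\<^bsub>qseries q\<^esub> (E (u \<otimes>\<^bsub>qseries q\<^esub> v) \<otimes>\<^bsub>qseries q\<^esub> E v)) a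
        = (\<Sum>i<D. \<Sum>k<D. \<Sum>j<D. ?c i * (?c k * (?c j * (q ^ (k choose 2) * W (i + k) (j + k) a))))"
      unfolding E_def sum_mult_left sum_mult_right W3
      by (simp add: sum_distrib_left smul_def)
    also have "\<dots> = (\<Sum>k<D. \<Sum>i<D. \<Sum>j<D. ?c i * (?c k * (?c j * (q ^ (k choose 2) * W (i + k) (j + k) a))))"
      by (rule sum.swap)
    also have "\<dots> = (\<Sum>k<D. q ^ (k choose 2) * ?c k * (\<Sum>i<D. ?c i * (\<Sum>j<D. ?c j * W (i + k) (j + k) a)))"
      by (simp add: sum_distrib_left mult_ac)
    also have "\<dots> = (\<Sum>k<D. q ^ (k choose 2) * ?c k * (\<Sum>n<D. ?d n k * (\<Sum>m<D. ?d m k * W n m a)))"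
      by (simp only: shift)
    also have "\<dots> = (\<Sum>k<D. \<Sum>n<D. \<Sum>m<D. q ^ (k choose 2) * ?c k * ?d n k * ?d m k * W n m a)"
      by (simp add: sum_distrib_left mult_ac)
    also have "\<dots> = (\<Sum>n<D. \<Sum>k<D. \<Sum>m<D. q ^ (k choose 2) * ?c k * ?d n k * ?d m k * W n m a)"
      by (rule sum.swap)
    also have "\<dots> = (\<Sum>n<D. \<Sum>m<D. \<Sum>k<D. q ^ (k choose 2) * ?c k * ?d n k * ?d m k * W n m a)"
      by (rule sum.cong[OF refl]) (rule sum.swap)
    also have "\<dots> = (\<Sum>n<D. \<Sum>m<D. q ^ (n * m) * ?c n * ?c m * W n m a)"
    proof (intro sum.cong refl)
      fix n m assume "n \<in> {..<D}" "m \<in> {..<D}"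
      then have "(\<Sum>k<D. q ^ (k choose 2) * ?c k * ?d n k * ?d m k) = (\<Sum>k\<le>n. q ^ (k choose 2) * ?c k * ?d n k * ?d m k)"
        by (intro sum.mono_neutral_right) (auto simp: eneg_coeff_diff_def)
      then show "(\<Sum>k<D. q ^ (k choose 2) * ?c k * ?d n k * ?d m k * W n m a) = q ^ (n * m) * ?c n * ?c m * W n m a"
        unfolding sum_distrib_right[symmetric] pentagon_coeff[OF q(2)] by simp
    qed
    finally show ?thesis .
  qed
  have "agree D (eneg q v \<otimes>\<^bsub>qseries q\<^esub> eneg q u) (E v \<otimes>\<^bsub>qseries q\<^esub> E u)"
    by (intro agree_mult E uv)
  moreover have "agree D (eneg q u \<otimes>\<^bsub>qseries q\<^esub> (eneg q (u \<otimes>\<^bsub>qseries q\<^esub> v) \<otimes>\<^bsub>qseries q\<^esub> eneg q v))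
      (E u \<otimes>\<^bsub>qseries q\<^esub> (E (u \<otimes>\<^bsub>qseries q\<^esub> v) \<otimes>\<^bsub>qseries q\<^esub> E v))"
    by (intro agree_mult E uv no_const_mult)
  ultimately show "agree D (eneg q v \<otimes>\<^bsub>qseries q\<^esub> eneg q u)
      (eneg q u \<otimes>\<^bsub>qseries q\<^esub> (eneg q (u \<otimes>\<^bsub>qseries q\<^esub> v) \<otimes>\<^bsub>qseries q\<^esub> eneg q v))"
    by (simp add: agree_def L R)
qed

subsection \<open>Ordered products\<close>

text \<open>The integer exponent adds up along products and changes sign under exchange; 0 is
  commutation, 1 the hypothesis of the pentagon.\<close>

definition qcommute :: "complex \<Rightarrow> int \<Rightarrow> 'n::nontriv series \<Rightarrow> 'n series \<Rightarrow> bool" where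
  "qcommute q k f g \<longleftrightarrow> f \<otimes>\<^bsub>qseries q\<^esub> g = smul (q powi k) (g \<otimes>\<^bsub>qseries q\<^esub> f)"

lemma qcommute_mult_right:
  assumes q: "q \<noteq> 0" and "qcommute q k f g" "qcommute q l f h"
  shows "qcommute q (k + l) f (g \<otimes>\<^bsub>qseries q\<^esub> h)"
proof -
  have "f \<otimes>\<^bsub>qseries q\<^esub> (g \<otimes>\<^bsub>qseries q\<^esub> h) = smul (q powi k) (g \<otimes>\<^bsub>qseries q\<^esub> (f \<otimes>\<^bsub>qseries q\<^esub> h))"
    using assms(2) by (simp add: qcommute_def mult_qseries_assoc[OF q, symmetric] smul_mult)
  then show ?thesis
    using assms(3) q by (simp add: qcommute_def mult_qseries_assoc[OF q] smul_mult smul_smul power_int_add)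
qed

lemma qcommute_sym:
  assumes "q \<noteq> 0" "qcommute q k f g"
  shows "qcommute q (- k) g f"
  using assms by (simp add: qcommute_def smul_smul smul_one flip: power_int_add)

lemma qcommute_mult_left:
  assumes "q \<noteq> 0" "qcommute q k f h" "qcommute q l g h"
  shows "qcommute q (k + l) (f \<otimes>\<^bsub>qseries q\<^esub> g) h"
  using qcommute_sym[OF assms(1) qcommute_mult_right[OF assms(1) qcommute_sym[OF assms(1,2)] qcommute_sym[OF assms(1,3)]]]
  by (simp add: add.commute)

lemma qcommute_0: "qcommute q 0 f g \<longleftrightarrow> f \<otimes>\<^bsub>qseries q\<^esub> g = g \<otimes>\<^bsub>qseries q\<^esub> f"
  by (simp add: qcommute_def smul_one)

lemma qcommute_1: "qcommute q 1 f g \<longleftrightarrow> f \<otimes>\<^bsub>qseries q\<^esub> g = smul q (g \<otimes>\<^bsub>qseries q\<^esub> f)"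
  by (simp add: qcommute_def)

lemma ordprod_Nil: "ordprod q [] = \<one>\<^bsub>qseries q\<^esub>"
  by (simp add: ordprod_def)

lemma ordprod_Cons: "ordprod q (f # fs) = f \<otimes>\<^bsub>qseries q\<^esub> ordprod q fs"
  by (simp add: ordprod_def)

lemma ordprod_singleton: "ordprod q [f] = f"
  by (simp add: ordprod_def mult_qseries_one)

lemma ordprod_append:
  assumes "q \<noteq> 0"
  shows "ordprod q (fs @ gs) = ordprod q fs \<otimes>\<^bsub>qseries q\<^esub> ordprod q gs"
  by (induction fs) (simp_all add: ordprod_Nil ordprod_Cons one_mult_qseries mult_qseries_assoc[OF assms])

lemma ordprod_commute:
  assumes q: "q \<noteq> 0" and "\<And>g. g \<in> set gs \<Longrightarrow> f \<otimes>\<^bsub>qseries q\<^esub> g = g \<otimes>\<^bsub>qseries q\<^esub> f"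
  shows "f \<otimes>\<^bsub>qseries q\<^esub> ordprod q gs = ordprod q gs \<otimes>\<^bsub>qseries q\<^esub> f"
  using assms(2)
proof (induction gs)
  case (Cons g gs)
  have "f \<otimes>\<^bsub>qseries q\<^esub> (g \<otimes>\<^bsub>qseries q\<^esub> ordprod q gs) = g \<otimes>\<^bsub>qseries q\<^esub> (f \<otimes>\<^bsub>qseries q\<^esub> ordprod q gs)"
    using Cons.prems[of g] by (simp add: mult_qseries_assoc[OF q, symmetric])
  then show ?case using Cons by (simp add: ordprod_Cons mult_qseries_assoc[OF q])
qed (simp add: ordprod_Nil one_mult_qseries mult_qseries_one)

lemma ordprod_inv:
  fixes fs :: "'n::nontriv series list"
  assumes q: "q \<noteq> 0" and "\<And>f. f \<in> set fs \<Longrightarrow> f \<in> Units (qseries q)"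
  defines "gs \<equiv> map (\<lambda>f. inv\<^bsub>qseries q\<^esub> f) (rev fs)"
  shows "ordprod q fs \<otimes>\<^bsub>qseries q\<^esub> ordprod q gs = \<one>\<^bsub>qseries q\<^esub> \<and>
    ordprod q gs \<otimes>\<^bsub>qseries q\<^esub> ordprod q fs = \<one>\<^bsub>qseries q\<^esub>"
  unfolding gs_def using assms(2)
proof (induction fs)
  case (Cons f fs)
  interpret ring "qseries q :: 'n series ring" by (rule ring_qseries[OF q])
  note assoc = mult_qseries_assoc[OF q]
  have f: "f \<otimes>\<^bsub>qseries q\<^esub> inv\<^bsub>qseries q\<^esub> f = \<one>\<^bsub>qseries q\<^esub>" "inv\<^bsub>qseries q\<^esub> f \<otimes>\<^bsub>qseries q\<^esub> f = \<one>\<^bsub>qseries q\<^esub>"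
    using Cons.prems[of f] by (simp_all add: Units_r_inv Units_l_inv)
  let ?P = "ordprod q fs" and ?I = "ordprod q (map (\<lambda>f. inv\<^bsub>qseries q\<^esub> f) (rev fs))"
  have IH: "?P \<otimes>\<^bsub>qseries q\<^esub> ?I = \<one>\<^bsub>qseries q\<^esub>" "?I \<otimes>\<^bsub>qseries q\<^esub> ?P = \<one>\<^bsub>qseries q\<^esub>"
    using Cons by simp_all
  have "f \<otimes>\<^bsub>qseries q\<^esub> ?P \<otimes>\<^bsub>qseries q\<^esub> (?I \<otimes>\<^bsub>qseries q\<^esub> inv\<^bsub>qseries q\<^esub> f)
      = f \<otimes>\<^bsub>qseries q\<^esub> (?P \<otimes>\<^bsub>qseries q\<^esub> ?I) \<otimes>\<^bsub>qseries q\<^esub> inv\<^bsub>qseries q\<^esub> f"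
    by (simp only: assoc)
  moreover have "?I \<otimes>\<^bsub>qseries q\<^esub> inv\<^bsub>qseries q\<^esub> f \<otimes>\<^bsub>qseries q\<^esub> (f \<otimes>\<^bsub>qseries q\<^esub> ?P)
      = ?I \<otimes>\<^bsub>qseries q\<^esub> (inv\<^bsub>qseries q\<^esub> f \<otimes>\<^bsub>qseries q\<^esub> f) \<otimes>\<^bsub>qseries q\<^esub> ?P"
    by (simp only: assoc)
  moreover have "ordprod q (map (\<lambda>f. inv\<^bsub>qseries q\<^esub> f) (rev (f # fs))) = ?I \<otimes>\<^bsub>qseries q\<^esub> inv\<^bsub>qseries q\<^esub> f"
    by (simp only: rev.simps map_append list.map ordprod_append[OF q] ordprod_singleton)
  ultimately show ?case
    by (simp only: ordprod_Cons IH f mult_qseries_one)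
qed (simp add: ordprod_Nil one_mult_qseries)

lemma ordprod_upt_Suc:
  "q \<noteq> 0 \<Longrightarrow> a \<le> b \<Longrightarrow>
    ordprod q (map f [a..<Suc b]) = ordprod q (map f [a..<b]) \<otimes>\<^bsub>qseries q\<^esub> f b"
  by (simp add: ordprod_append ordprod_singleton)

lemma ordprod_upt_Cons:
  "a < b \<Longrightarrow> ordprod q (map f [a..<b]) = f a \<otimes>\<^bsub>qseries q\<^esub> ordprod q (map f [Suc a..<b])"
  by (simp add: upt_conv_Cons ordprod_Cons)

lemma ordprod_rev_upt_Suc:
  "ordprod q (map f (rev [0..<Suc b])) = f b \<otimes>\<^bsub>qseries q\<^esub> ordprod q (map f (rev [0..<b]))"
  by (simp add: ordprod_Cons)

section \<open>Descending strings of generators and their commutation exponents\<close>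

lemma of_nat_mod_ring_eq_iff:
  "of_nat k = (of_nat l :: 'n::nontriv mod_ring) \<longleftrightarrow> k mod CARD('n) = l mod CARD('n)"
  by (simp add: of_nat_eq_iff_cong_CHAR cong_def)

lemma diff_of_nat_mod_ring:
  "k \<le> CARD('n) \<Longrightarrow> i - of_nat k = (i + of_nat (CARD('n) - k) :: 'n::nontriv mod_ring)"
  by (simp add: of_nat_diff)

text \<open>Writes the generator just above a string as one at offset N - 1 below its top, the form
  that the commutation lemmas expect.\<close>

lemma diff_card_pred_mod_ring: "i - of_nat (CARD('n) - 1) = (i + 1 :: 'n::nontriv mod_ring)"
  by (subst diff_of_nat_mod_ring) (simp_all add: Suc_leI)

lemma desc_prod_0: "desc_prod q \<alpha> i 0 = xhat \<alpha> i"
  by (simp add: desc_prod_def ordprod_singleton)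

lemma desc_prod_Suc:
  "q \<noteq> 0 \<Longrightarrow> desc_prod q \<alpha> i (Suc m) = desc_prod q \<alpha> i m \<otimes>\<^bsub>qseries q\<^esub> xhat \<alpha> (i - of_nat (Suc m))"
  using ordprod_upt_Suc[of q 0 "Suc m" "\<lambda>k. xhat \<alpha> (i - of_nat k)"] by (simp add: desc_prod_def del: upt_Suc)

text \<open>Counterpart of \<open>desc_prod_Suc\<close> at the top end:
  \<open>dexp_gexp_succ\<close> grows strings there, \<open>gexp_pred_dexp\<close> at the
  bottom.\<close>

lemma desc_prod_Suc':
  "desc_prod q \<alpha> i (Suc m) = xhat \<alpha> i \<otimes>\<^bsub>qseries q\<^esub> desc_prod q \<alpha> (i - 1) m"
proof -
  have "[0..<Suc m + 1] = 0 # map Suc [0..<m + 1]"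
    by (subst map_Suc_upt) (simp add: upt_conv_Cons del: upt_Suc)
  then show ?thesis
    by (simp add: desc_prod_def ordprod_Cons o_def algebra_simps del: upt_Suc)
qed

lemma no_const_desc_prod: "no_const (desc_prod q \<alpha> i m)"
  by (cases m) (simp_all add: desc_prod_0 desc_prod_Suc' no_const_mult no_const_xhat)

text \<open>Indices become offsets below \<open>i\<close>, where cyclic adjacency is adjacency of
  numbers up to wrap-around. The bound on \<open>k\<close> leaves one wrapped case: T = N - 1 next
  to k = 0.\<close>

lemma qcommute_xhat:
  fixes \<alpha> :: "'n::nontriv mod_ring \<Rightarrow> complex"
  assumes q: "q \<noteq> 0" and T: "T < CARD('n)" and k: "k + 2 \<le> CARD('n)"
  shows "qcommute q (of_bool (T = Suc k) - of_bool (k = Suc T \<or> (k = 0 \<and> Suc T = CARD('n))))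
    (xhat \<alpha> (i - of_nat T)) (xhat \<alpha> (i - of_nat k))"
proof -
  have "i - of_nat T = i - of_nat k - 1 \<longleftrightarrow> of_nat T = (of_nat (Suc k) :: 'n mod_ring)"
    by (auto simp: algebra_simps) 
  also have "\<dots> \<longleftrightarrow> T = Suc k"
    unfolding of_nat_mod_ring_eq_iff using T k by simp
  finally have 1: "i - of_nat T = i - of_nat k - 1 \<longleftrightarrow> T = Suc k" .
  have "i - of_nat T - 1 = i - of_nat k \<longleftrightarrow> of_nat (Suc T) = (of_nat k :: 'n mod_ring)"
    by (auto simp: algebra_simps)
  also have "\<dots> \<longleftrightarrow> k = Suc T \<or> (k = 0 \<and> Suc T = CARD('n))"
    unfolding of_nat_mod_ring_eq_iff using T k by (cases "Suc T = CARD('n)") auto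
  finally have 2: "i - of_nat T - 1 = i - of_nat k \<longleftrightarrow> k = Suc T \<or> (k = 0 \<and> Suc T = CARD('n))" .
  show ?thesis
    using xhat_commute[OF q, of \<alpha> "i - of_nat T" "i - of_nat k"]
    unfolding qcommute_def 1 2 of_bool_def by simp
qed

text \<open>Only the two neighbours of offset T count. The upper one, T - 1, lies in the string iff
  1 <= T <= m + 1 and contributes +1; the lower one, T + 1 or after wrapping 0, contributes
  -1.\<close>

lemma qcommute_xhat_desc_prod:
  fixes \<alpha> :: "'n::nontriv mod_ring \<Rightarrow> complex"
  assumes q: "q \<noteq> 0" and T: "T < CARD('n)" and m: "m + 2 \<le> CARD('n)"
  shows "qcommute q (of_bool (1 \<le> T \<and> T \<le> Suc m) - of_bool (Suc T \<le> m \<or> Suc T = CARD('n)))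
    (xhat \<alpha> (i - of_nat T)) (desc_prod q \<alpha> i m)"
  using m
proof (induction m)
  case 0
  have "of_bool (1 \<le> T \<and> T \<le> Suc 0) - of_bool (Suc T \<le> 0 \<or> Suc T = CARD('n)) =
      (of_bool (T = Suc 0) - of_bool (0 = Suc T \<or> (0 = (0::nat) \<and> Suc T = CARD('n))) :: int)"
    by auto
  then show ?case
    using qcommute_xhat[OF q T 0, of \<alpha> i] by (simp only: desc_prod_0) simp
next
  case (Suc m)
  have "of_bool (1 \<le> T \<and> T \<le> Suc (Suc m)) - of_bool (Suc T \<le> Suc m \<or> Suc T = CARD('n)) =
      (of_bool (1 \<le> T \<and> T \<le> Suc m) - of_bool (Suc T \<le> m \<or> Suc T = CARD('n))) +
      (of_bool (T = Suc (Suc m)) - of_bool (Suc m = Suc T \<or> (Suc m = 0 \<and> Suc T = CARD('n))) :: int)"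
    using Suc.prems by (auto simp: le_Suc_eq)
  then show ?case
    unfolding desc_prod_Suc[OF q]
    using qcommute_mult_right[OF q Suc.IH qcommute_xhat[OF q T Suc.prems]] Suc.prems by simp
qed

text \<open>Each generator of the shorter string lies strictly inside the longer one, where its two
  neighbours cancel.\<close>

lemma desc_prod_commute:
  fixes \<alpha> :: "'n::nontriv mod_ring \<Rightarrow> complex"
  assumes q: "q \<noteq> 0" and "a + 2 \<le> b" "b + 2 \<le> CARD('n)"
  shows "qcommute q 0 (desc_prod q \<alpha> p a) (desc_prod q \<alpha> (p + 1) b)"
  using assms(2)
proof (induction a)
  case 0
  then show ?case
    using qcommute_xhat_desc_prod[OF q, of 1 b \<alpha> "p + 1"] assms(3) by (simp add: desc_prod_0)
next
  case (Suc a)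
  have e: "p - of_nat (Suc a) = p + 1 - of_nat (Suc (Suc a))" by simp
  have "qcommute q 0 (xhat \<alpha> (p - of_nat (Suc a))) (desc_prod q \<alpha> (p + 1) b)"
    unfolding e using qcommute_xhat_desc_prod[OF q, of "Suc (Suc a)" b \<alpha> "p + 1"] Suc.prems assms(3)
    by (simp del: of_nat_Suc)
  then show ?case
    using qcommute_mult_left[OF q Suc.IH, of 0] Suc.prems by (simp add: desc_prod_Suc[OF q])
qed

section \<open>Exchange rules and reordering of products\<close>

context
  fixes q :: complex and \<alpha> :: "'n::nontriv mod_ring \<Rightarrow> complex"
  assumes q: "q \<noteq> 0" "norm q < 1"
begin

abbreviation mult_q (infixl "\<cdot>" 70) where "f \<cdot> g \<equiv> f \<otimes>\<^bsub>qseries q\<^esub> (g :: 'n series)"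
abbreviation "gexp i \<equiv> eneg q (xhat \<alpha> i)"
abbreviation "dexp i m \<equiv> eneg q (desc_prod q \<alpha> i m)"

lemmas assoc = mult_qseries_assoc[OF q(1)]
lemmas prod_append = ordprod_append[OF q(1)]

text \<open>Offset T has cyclic distance at least 2 from the string: the lower bound on T keeps it
  off the bottom end, the upper bound off the top.\<close>

lemma dexp_gexp_commute:
  assumes "m + 2 \<le> T" "T + 2 \<le> CARD('n)"
  shows "gexp (i - of_nat T) \<cdot> dexp i m = dexp i m \<cdot> gexp (i - of_nat T)"
proof (rule eneg_commute[OF q(1) no_const_xhat no_const_desc_prod])
  show "xhat \<alpha> (i - of_nat T) \<cdot> desc_prod q \<alpha> i m = desc_prod q \<alpha> i m \<cdot> xhat \<alpha> (i - of_nat T)"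
    using qcommute_xhat_desc_prod[OF q(1), of T m \<alpha> i] assms by (simp add: qcommute_0)
qed

text \<open>The bound on m makes x_(i+1) touch the string at its top only. In the pentagon the
  string is v and x_(i+1) is u, so u v is the string grown at the top.\<close>

lemma dexp_gexp_succ:
  assumes "m + 3 \<le> CARD('n)"
  shows "dexp i m \<cdot> gexp (i + 1) = gexp (i + 1) \<cdot> (dexp (i + 1) (Suc m) \<cdot> dexp i m)"
proof -
  have "CARD('n) - 1 < CARD('n)" "m + 2 \<le> CARD('n)"
    "of_bool (1 \<le> CARD('n) - 1 \<and> CARD('n) - 1 \<le> Suc m) - of_bool (Suc (CARD('n) - 1) \<le> m \<or> Suc (CARD('n) - 1) = CARD('n)) = (- 1 :: int)"
    using assms by auto
  then have "qcommute q (- 1) (xhat \<alpha> (i + 1)) (desc_prod q \<alpha> i m)"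
    using qcommute_xhat_desc_prod[OF q(1), of "CARD('n) - 1" m \<alpha> i] by (simp only: diff_card_pred_mod_ring)
  from pentagon[OF q no_const_xhat no_const_desc_prod qcommute_sym[OF q(1) this, simplified qcommute_1 minus_minus]]
  show ?thesis by (simp add: desc_prod_Suc')
qed

text \<open>The string has N - 1 generators and x_(i+1) is the missing one, adjacent to both ends;
  the factors q and q^(-1) cancel.\<close>

lemma dexp_gexp_succ_wrap:
  assumes "m + 2 = CARD('n)"
  shows "dexp i m \<cdot> gexp (i + 1) = gexp (i + 1) \<cdot> dexp i m"
proof (rule eneg_commute[OF q(1) no_const_desc_prod no_const_xhat])
  have "CARD('n) - 1 < CARD('n)" "m + 2 \<le> CARD('n)"
    "of_bool (1 \<le> CARD('n) - 1 \<and> CARD('n) - 1 \<le> Suc m) - of_bool (Suc (CARD('n) - 1) \<le> m \<or> Suc (CARD('n) - 1) = CARD('n)) = (0 :: int)"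
    using assms by auto
  then have "qcommute q 0 (xhat \<alpha> (i + 1)) (desc_prod q \<alpha> i m)"
    using qcommute_xhat_desc_prod[OF q(1), of "CARD('n) - 1" m \<alpha> i] by (simp only: diff_card_pred_mod_ring)
  then show "desc_prod q \<alpha> i m \<cdot> xhat \<alpha> (i + 1) = xhat \<alpha> (i + 1) \<cdot> desc_prod q \<alpha> i m"
    by (simp add: qcommute_0)
qed

text \<open>Mirror image of \<open>dexp_gexp_succ\<close>: the string is u, the generator just below
  it is v, and the string grows at the bottom.\<close>

lemma gexp_pred_dexp:
  assumes "m + 3 \<le> CARD('n)"
  shows "gexp (i - of_nat (Suc m)) \<cdot> dexp i m = dexp i m \<cdot> (dexp i (Suc m) \<cdot> gexp (i - of_nat (Suc m)))"
proof -
  have "qcommute q 1 (xhat \<alpha> (i - of_nat (Suc m))) (desc_prod q \<alpha> i m)"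
    using qcommute_xhat_desc_prod[OF q(1), of "Suc m" m \<alpha> i] assms by simp
  from pentagon[OF q no_const_desc_prod no_const_xhat this[unfolded qcommute_1]]
  show ?thesis by (simp add: desc_prod_Suc[OF q(1)])
qed

lemma dexp_dexp_commute:
  assumes "a + 2 \<le> b" "b + 2 \<le> CARD('n)"
  shows "dexp (p + 1) b \<cdot> dexp p a = dexp p a \<cdot> dexp (p + 1) b"
  by (rule eneg_commute[OF q(1) no_const_desc_prod no_const_desc_prod])
    (use desc_prod_commute[OF q(1) assms, of \<alpha> p] in \<open>simp add: qcommute_0\<close>)

text \<open>All strings end at x_i. A new factor E(x_(i+m+1)) is too far from the shorter ones to
  interact and meets only the longest, where \<open>dexp_gexp_succ\<close> creates the next
  string.\<close>

lemma ordprod_gexp_ascending: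
  assumes "m + 2 \<le> CARD('n)"
  shows "ordprod q (map (\<lambda>k. gexp (i + of_nat k)) [0..<Suc m]) =
    ordprod q (map (\<lambda>k. gexp (i + of_nat k)) [1..<Suc m]) \<cdot> ordprod q (map (\<lambda>s. dexp (i + of_nat s) s) (rev [0..<Suc m]))"
  using assms
proof (induction m)
  case 0
  show ?case by (simp add: ordprod_singleton ordprod_Nil one_mult_qseries desc_prod_0)
next
  case (Suc m)
  let ?e = "gexp (i + of_nat (Suc m))" and ?d = "dexp (i + of_nat m) m"
  let ?D = "ordprod q (map (\<lambda>s. dexp (i + of_nat s) s) (rev [0..<m]))"
  let ?P = "ordprod q (map (\<lambda>k. gexp (i + of_nat k)) [1..<Suc m])"
  have "?D \<cdot> ?e = ?e \<cdot> ?D"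
  proof (rule ordprod_commute[OF q(1), symmetric], clarsimp)
    fix s assume s: "s < m"
    then have "i + (1 + of_nat m) = i + of_nat s - of_nat (CARD('n) - (Suc m - s))"
      using Suc.prems by (subst diff_of_nat_mod_ring) (simp_all add: of_nat_diff)
    then show "gexp (i + (1 + of_nat m)) \<cdot> dexp (i + of_nat s) s = dexp (i + of_nat s) s \<cdot> gexp (i + (1 + of_nat m))"
      using dexp_gexp_commute[of s "CARD('n) - (Suc m - s)" "i + of_nat s"] s Suc.prems by simp
  qed
  then have "?P \<cdot> (?d \<cdot> ?D) \<cdot> ?e = ?P \<cdot> (?d \<cdot> ?e) \<cdot> ?D"
    by (simp add: assoc)
  also have "?d \<cdot> ?e = ?e \<cdot> (dexp (i + of_nat (Suc m)) (Suc m) \<cdot> ?d)"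
    using dexp_gexp_succ[of m "i + of_nat m"] Suc.prems by (simp add: algebra_simps)
  finally have "?P \<cdot> (?d \<cdot> ?D) \<cdot> ?e = ?P \<cdot> ?e \<cdot> (dexp (i + of_nat (Suc m)) (Suc m) \<cdot> (?d \<cdot> ?D))"
    by (simp only: assoc)
  moreover have "ordprod q (map (\<lambda>k. gexp (i + of_nat k)) [0..<Suc m]) = ?P \<cdot> (?d \<cdot> ?D)"
    using Suc.IH Suc.prems unfolding ordprod_rev_upt_Suc by simp
  moreover have "ordprod q (map (\<lambda>k. gexp (i + of_nat k)) [1..<Suc (Suc m)]) = ?P \<cdot> ?e"
    by (rule ordprod_upt_Suc[OF q(1)]) simp
  ultimately show ?case
    by (simp only: ordprod_upt_Suc[OF q(1) le0, of _ "Suc m"] ordprod_rev_upt_Suc)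
qed

text \<open>E(x_(p+N)) = E(x_p) travels to the left. Going down from l = N, a factor put in front
  commutes with all strings from x_p but the longest, whose bottom it extends. At l = 1 the factor
  E(x_(p+1)) would also touch the top x_p.\<close>

lemma ordprod_gexp_ascending_last:
  assumes "2 \<le> l" "l \<le> CARD('n)"
  shows "ordprod q (map (\<lambda>k. gexp (p + of_nat k)) [l..<Suc CARD('n)]) =
    ordprod q (map (\<lambda>s. dexp p s) [0..<Suc CARD('n) - l]) \<cdot> ordprod q (map (\<lambda>k. gexp (p + of_nat k)) [l..<CARD('n)])"
  using assms(2,1)
proof (induction l rule: inc_induct)
  case base
  show ?case by (simp add: ordprod_singleton ordprod_Nil mult_qseries_one desc_prod_0)
next
  case (step l)
  \<comment> \<open>The string \<open>dexp p r\<close> ends at x_(p+l+1), so x_(p+l) is the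
    generator just below it.\<close>
  define r where "r = CARD('n) - Suc l"
  have r: "Suc CARD('n) - l = Suc (Suc r)" "Suc CARD('n) - Suc l = Suc r" "r + 3 \<le> CARD('n)"
    using step by (auto simp: r_def)
  let ?e = "gexp (p + of_nat l)"
  let ?D = "ordprod q (map (\<lambda>s. dexp p s) [0..<r])"
  let ?Q = "ordprod q (map (\<lambda>k. gexp (p + of_nat k)) [Suc l..<CARD('n)])"
  have e: "p + of_nat l = p - of_nat (Suc r)"
    using step by (subst diff_of_nat_mod_ring) (auto simp: r_def)
  have "?e \<cdot> ?D = ?D \<cdot> ?e"
    by (rule ordprod_commute[OF q(1)])
      (use dexp_gexp_commute[of _ "Suc r" p, folded e] r in auto)
  then have "?e \<cdot> (?D \<cdot> dexp p r \<cdot> ?Q) = ?D \<cdot> (?e \<cdot> dexp p r) \<cdot> ?Q"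
    by (simp add: assoc[symmetric])
  also have "?e \<cdot> dexp p r = dexp p r \<cdot> (dexp p (Suc r) \<cdot> ?e)"
    unfolding e by (rule gexp_pred_dexp[OF r(3)])
  finally have "?e \<cdot> (?D \<cdot> dexp p r \<cdot> ?Q) = ?D \<cdot> dexp p r \<cdot> dexp p (Suc r) \<cdot> (?e \<cdot> ?Q)"
    by (simp only: assoc)
  moreover have "ordprod q (map (\<lambda>k. gexp (p + of_nat k)) [l..<Suc CARD('n)])
      = ?e \<cdot> ordprod q (map (\<lambda>k. gexp (p + of_nat k)) [Suc l..<Suc CARD('n)])"
    "ordprod q (map (\<lambda>k. gexp (p + of_nat k)) [l..<CARD('n)]) = ?e \<cdot> ?Q"
    by (rule ordprod_upt_Cons, use step in simp)+
  moreover have "ordprod q (map (\<lambda>k. gexp (p + of_nat k)) [Suc l..<Suc CARD('n)]) = ?D \<cdot> dexp p r \<cdot> ?Q"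
    using step.IH step.prems unfolding r(2) ordprod_upt_Suc[OF q(1) le0] by simp
  ultimately show ?case
    unfolding r by (simp only: ordprod_upt_Suc[OF q(1) le0])
qed

text \<open>Passing the string \<open>dexp p s\<close> creates \<open>dexp (p + 1) (s + 1)\<close>,
  which commutes with the strings from x_p shorter than \<open>dexp p s\<close> and so moves to its
  place on the left. The bound on \<open>M\<close> excludes the full string of N - 1
  generators.\<close>

lemma ordprod_dexp_gexp:
  assumes "M + 2 \<le> CARD('n)"
  shows "ordprod q (map (dexp p) [0..<M]) \<cdot> gexp (p + 1) =
    ordprod q (map (dexp (p + 1)) [0..<Suc M]) \<cdot> ordprod q (map (dexp p) [0..<M])"
  using assms
proof (induction M)
  case 0
  show ?case by (simp add: ordprod_singleton ordprod_Nil one_mult_qseries mult_qseries_one desc_prod_0)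
next
  case (Suc M)
  let ?D = "ordprod q (map (dexp p) [0..<M])" and ?D' = "ordprod q (map (dexp (p + 1)) [0..<Suc M])"
  let ?d' = "dexp (p + 1) (Suc M)"
  have 1: "?D \<cdot> ?d' = ?d' \<cdot> ?D"
    by (rule ordprod_commute[OF q(1), symmetric]) (use Suc.prems dexp_dexp_commute in auto)
  have 2: "dexp p M \<cdot> gexp (p + 1) = gexp (p + 1) \<cdot> (?d' \<cdot> dexp p M)"
    using dexp_gexp_succ Suc.prems by simp
  have "?D \<cdot> dexp p M \<cdot> gexp (p + 1) = ?D \<cdot> gexp (p + 1) \<cdot> (?d' \<cdot> dexp p M)"
    by (simp only: assoc 2)
  also have "?D \<cdot> gexp (p + 1) = ?D' \<cdot> ?D" using Suc by simp
  also have "?D' \<cdot> ?D \<cdot> (?d' \<cdot> dexp p M) = ?D' \<cdot> ?d' \<cdot> (?D \<cdot> dexp p M)"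
    by (simp add: assoc) (simp add: assoc[symmetric] 1)
  finally show ?case
    by (simp only: ordprod_upt_Suc[OF q(1) le0])
qed

lemma map_gexp_shift:
  "map (\<lambda>k. gexp (p + 1 + of_nat k)) [a..<b] = map (\<lambda>k. gexp (p + of_nat k)) [Suc a..<Suc b]"
  by (simp add: map_Suc_upt[symmetric] o_def add.assoc del: upt_Suc)

lemma prodB_upper_eq:
  "prodB_upper q \<alpha> p = ordprod q (map (dexp p) [0..<CARD('n) - 1]) \<cdot> ordprod q (map (\<lambda>k. gexp (p + of_nat k)) [1..<CARD('n)])"
  by (simp add: prodB_upper_def prod_append)

lemma prodB_upper_shift:
  assumes N: "CARD('n) \<ge> 3"
  shows "prodB_upper q \<alpha> (p + 1) = prodB_upper q \<alpha> p"
proof -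
  define M where "M = CARD('n) - 2"
  have M: "CARD('n) = Suc (Suc M)" "M \<ge> 1" using N by (auto simp: M_def)
  let ?D = "ordprod q (map (dexp p) [0..<M])" and ?D' = "ordprod q (map (dexp (p + 1)) [0..<Suc M])"
  let ?Q = "ordprod q (map (\<lambda>k. gexp (p + of_nat k)) [2..<CARD('n)])"
  have "prodB_upper q \<alpha> p = ?D \<cdot> dexp p M \<cdot> (gexp (p + 1) \<cdot> ?Q)"
    using ordprod_upt_Suc[OF q(1) le0, of "dexp p" M] ordprod_upt_Cons[of 1 "CARD('n)" q "\<lambda>k. gexp (p + of_nat k)"] M
    by (simp add: prodB_upper_eq numeral_2_eq_2 del: upt_Suc)
  also have "\<dots> = ?D \<cdot> (dexp p M \<cdot> gexp (p + 1)) \<cdot> ?Q" by (simp only: assoc)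
  \<comment> \<open>The full string lets E(x_(p+1)) pass without creating a new one; only the M
    shorter strings do.\<close>
  also have "dexp p M \<cdot> gexp (p + 1) = gexp (p + 1) \<cdot> dexp p M"
    by (rule dexp_gexp_succ_wrap) (use M in simp)
  also have "?D \<cdot> (gexp (p + 1) \<cdot> dexp p M) = ?D \<cdot> gexp (p + 1) \<cdot> dexp p M" by (simp only: assoc)
  also have "?D \<cdot> gexp (p + 1) = ?D' \<cdot> ?D" by (rule ordprod_dexp_gexp) (use M in simp)
  also have "?D' \<cdot> ?D \<cdot> dexp p M \<cdot> ?Q = ?D' \<cdot> (?D \<cdot> dexp p M \<cdot> ?Q)" by (simp only: assoc)
  \<comment> \<open>The reordering rule backwards: the strings from x_p fold into a last factor
    E(x_(p+N)), giving the ascending tail of the product at p + 1.\<close>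
  also have "?D \<cdot> dexp p M \<cdot> ?Q = ordprod q (map (\<lambda>k. gexp (p + of_nat k)) [2..<Suc CARD('n)])"
    using ordprod_gexp_ascending_last[of 2 p] ordprod_upt_Suc[OF q(1) le0, of "dexp p" M] M by (simp del: upt_Suc)
  also have "?D' \<cdot> \<dots> = prodB_upper q \<alpha> (p + 1)"
    using M by (simp add: prodB_upper_eq map_gexp_shift numeral_2_eq_2 del: upt_Suc)
  finally show ?thesis ..
qed

section \<open>From the product A to the two forms of B\<close>

lemma prodA_eq:
  fixes i
  defines "P \<equiv> map (\<lambda>k. gexp (i + of_nat k)) [1..<CARD('n) - 1]"
  shows "prodA q \<alpha> i = ordprod q P \<cdot> gexp (i + of_nat (CARD('n) - 1)) \<cdot>
    ordprod q (map (\<lambda>f. inv\<^bsub>qseries q\<^esub> f) (rev P)) \<cdot> gexp i \<cdot> ordprod q P"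
  by (simp add: prodA_def P_def prod_append ordprod_singleton ordprod_Cons assoc rev_map o_def)

lemma inverse_prod:
  fixes i
  defines "P \<equiv> map (\<lambda>k. gexp (i + of_nat k)) [1..<CARD('n) - 1]"
  shows "ordprod q P \<cdot> ordprod q (map (\<lambda>f. inv\<^bsub>qseries q\<^esub> f) (rev P)) = \<one>\<^bsub>qseries q\<^esub>"
    "ordprod q (map (\<lambda>f. inv\<^bsub>qseries q\<^esub> f) (rev P)) \<cdot> ordprod q P = \<one>\<^bsub>qseries q\<^esub>"
proof -
  have "gexp k \<in> Units (qseries q)" for k
    by (intro unit_if_const_1 eneg_const no_const_xhat q(1))
  then show "ordprod q P \<cdot> ordprod q (map (\<lambda>f. inv\<^bsub>qseries q\<^esub> f) (rev P)) = \<one>\<^bsub>qseries q\<^esub>"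
    "ordprod q (map (\<lambda>f. inv\<^bsub>qseries q\<^esub> f) (rev P)) \<cdot> ordprod q P = \<one>\<^bsub>qseries q\<^esub>"
    using ordprod_inv[OF q(1), of P] by (auto simp: P_def)
qed

lemma prodA_eq_prodB_lower:
  assumes N: "CARD('n) \<ge> 3"
  shows "prodA q \<alpha> i = prodB_lower q \<alpha> i"
proof -
  define M where "M = CARD('n) - 2"
  have M: "CARD('n) = Suc (Suc M)" "M \<ge> 1" using N by (auto simp: M_def)
  define P where "P = map (\<lambda>k. gexp (i + of_nat k)) [1..<CARD('n) - 1]"
  let ?I = "ordprod q (map (\<lambda>f. inv\<^bsub>qseries q\<^esub> f) (rev P))"
  let ?D = "ordprod q (map (\<lambda>m. dexp (i + of_nat m) m) (rev [0..<CARD('n) - 1]))"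
  have "gexp i \<cdot> ordprod q P = ordprod q (map (\<lambda>k. gexp (i + of_nat k)) [0..<Suc M])"
    by (simp add: P_def M upt_conv_Cons ordprod_Cons del: upt_Suc)
  also have "\<dots> = ordprod q P \<cdot> ?D"
    using ordprod_gexp_ascending[of M i] by (simp add: M P_def del: upt_Suc)
  finally have "?I \<cdot> (gexp i \<cdot> ordprod q P) = ?D"
    using inverse_prod[of i, folded P_def] by (simp add: assoc[symmetric] one_mult_qseries)
  then have "prodA q \<alpha> i = ordprod q P \<cdot> gexp (i + of_nat (CARD('n) - 1)) \<cdot> ?D"
    unfolding prodA_eq P_def[symmetric] by (simp only: assoc)
  also have "\<dots> = prodB_lower q \<alpha> i"
    by (simp add: prodB_lower_def P_def M prod_append ordprod_singleton ordprod_Cons assoc)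
  finally show ?thesis .
qed

text \<open>The middle factor of A at p + 1 has index p + N = p, so its strings start at x_p. It
  moves left through \<open>P\<close>, and the copy of \<open>P\<close> left behind cancels against
  the inverses.\<close>

lemma prodA_eq_prodB_upper:
  assumes N: "CARD('n) \<ge> 3"
  shows "prodA q \<alpha> (p + 1) = prodB_upper q \<alpha> p"
proof -
  define M where "M = CARD('n) - 2"
  have M: "CARD('n) = Suc (Suc M)" "M \<ge> 1" using N by (auto simp: M_def)
  define P where "P = map (\<lambda>k. gexp (p + 1 + of_nat k)) [1..<CARD('n) - 1]"
  let ?I = "ordprod q (map (\<lambda>f. inv\<^bsub>qseries q\<^esub> f) (rev P))"
  let ?D = "ordprod q (map (dexp p) [0..<CARD('n) - 1])"
  let ?e = "gexp (p + 1 + of_nat (CARD('n) - 1))"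
  have "ordprod q P \<cdot> ?e = ordprod q (map (\<lambda>k. gexp (p + 1 + of_nat k)) [1..<Suc (CARD('n) - 1)])"
    unfolding P_def by (rule ordprod_upt_Suc[OF q(1), symmetric]) (use M in simp)
  also have "\<dots> = ordprod q (map (\<lambda>k. gexp (p + of_nat k)) [2..<Suc CARD('n)])"
    unfolding map_gexp_shift by (simp add: M numeral_2_eq_2)
  also have "\<dots> = ?D \<cdot> ordprod q (map (\<lambda>k. gexp (p + of_nat k)) [2..<CARD('n)])"
    using ordprod_gexp_ascending_last[of 2 p] M by (simp del: upt_Suc)
  also have "map (\<lambda>k. gexp (p + of_nat k)) [2..<CARD('n)] = P"
    unfolding P_def map_gexp_shift by (simp add: M numeral_2_eq_2)
  finally have e: "ordprod q P \<cdot> ?e = ?D \<cdot> ordprod q P" .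
  have "prodA q \<alpha> (p + 1) = ?D \<cdot> (ordprod q P \<cdot> ?I) \<cdot> (gexp (p + 1) \<cdot> ordprod q P)"
    unfolding prodA_eq P_def[symmetric] e by (simp only: assoc)
  also have "\<dots> = ?D \<cdot> (gexp (p + 1) \<cdot> ordprod q P)"
    using inverse_prod[of "p + 1", folded P_def] by (simp add: mult_qseries_one)
  also have "gexp (p + 1) \<cdot> ordprod q P = ordprod q (map (\<lambda>k. gexp (p + 1 + of_nat k)) [0..<Suc M])"
    by (simp add: P_def M upt_conv_Cons ordprod_Cons del: upt_Suc)
  also have "\<dots> = ordprod q (map (\<lambda>k. gexp (p + of_nat k)) [1..<CARD('n)])"
    unfolding map_gexp_shift by (simp add: M)
  finally show ?thesis unfolding prodB_upper_eq .
qed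

end

subsection \<open>Dynkin automorphisms\<close>

lemma linear_sum:
  fixes \<phi> :: "'n::nontriv series \<Rightarrow> 'n series"
  assumes lin: "\<And>c f. \<phi> (smul c f) = smul c (\<phi> f)"
    and add: "\<And>f g. \<phi> (\<lambda>a. f a + g a) = (\<lambda>a. \<phi> f a + \<phi> g a)"
  shows "\<phi> (\<lambda>a. \<Sum>n<m. c n * F n a) = (\<lambda>a. \<Sum>n<(m::nat). c n * \<phi> (F n) a)"
proof (induction m)
  case 0
  show ?case using lin[of 0 "\<lambda>a. 0"] by (simp add: smul_def)
next
  case (Suc m)
  have "\<phi> (\<lambda>a. (\<Sum>n<m. c n * F n a) + smul (c m) (F m) a) = (\<lambda>a. (\<Sum>n<m. c n * \<phi> (F n) a) + smul (c m) (\<phi> (F m)) a)"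
    unfolding add Suc lin ..
  then show ?case by (simp add: smul_def)
qed

text \<open>Continuity sends a late enough tail of the exponential above degree \<open>D\<close>, so
  linearity and powers decide. Compatibility with powers is a hypothesis in terms of
  \<open>qseries\<close> itself, so that one lemma serves automorphisms and
  anti-automorphisms.\<close>

lemma alg_iso_eneg:
  fixes z :: "'n::nontriv series"
  assumes q: "q \<noteq> 0" and iso: "alg_iso (qseries q) S \<phi>"
    and S: "\<And>f g. f \<oplus>\<^bsub>S\<^esub> g = (\<lambda>a. f a + g a)"
    and pow: "\<And>n::nat. \<phi> (z [^]\<^bsub>qseries q\<^esub> n) = \<phi> z [^]\<^bsub>qseries q\<^esub> n"
    and z: "no_const z" "no_const (\<phi> z)"
  shows "\<phi> (eneg q z) = eneg q (\<phi> z)"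
proof (rule agree_imp_eq)
  fix D
  have lin: "\<phi> (smul c f) = smul c (\<phi> f)" for c f
    using iso by (simp add: alg_iso_def)
  have add: "\<phi> (\<lambda>a. f a + g a) = (\<lambda>a. \<phi> f a + \<phi> g a)" for f g
    using iso Ring.ring_hom_add[of \<phi> "qseries q" S f g]
    by (simp add: alg_iso_def ring_iso_def S qseries_sel)
  obtain m where m: "\<And>f a. (\<And>a. edeg a < m \<Longrightarrow> f a = 0) \<Longrightarrow> edeg a < D \<Longrightarrow> \<phi> f a = 0"
    using iso unfolding alg_iso_def by meson
  \<comment> \<open>\<open>m\<close> controls the image of the remainder, \<open>D\<close> the
    truncation of the exponential of the image.\<close>
  define M where "M = max m D"
  define t where "t = (\<lambda>a. \<Sum>n<M. eneg_coeff q n * (z [^]\<^bsub>qseries q\<^esub> n) a)"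
  define r where "r = (\<lambda>a. eneg q z a - t a)"
  have "agree m (eneg q z) t"
    unfolding t_def by (rule agree_eneg[OF q z(1)]) (simp add: M_def)
  then have "\<phi> r a = 0" if "edeg a < D" for a
    by (intro m[OF _ that]) (simp add: r_def agree_def)
  moreover have "\<phi> (eneg q z) = (\<lambda>a. \<phi> t a + \<phi> r a)"
    unfolding add[symmetric] by (simp add: r_def)
  moreover have "\<phi> t = (\<lambda>a. \<Sum>n<M. eneg_coeff q n * (\<phi> z [^]\<^bsub>qseries q\<^esub> n) a)"
    unfolding t_def linear_sum[OF lin add] pow ..
  moreover have "agree D (eneg q (\<phi> z)) (\<lambda>a. \<Sum>n<M. eneg_coeff q n * (\<phi> z [^]\<^bsub>qseries q\<^esub> n) a)"
    by (rule agree_eneg[OF q z(2)]) (simp add: M_def)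
  ultimately show "agree D (\<phi> (eneg q z)) (eneg q (\<phi> z))"
    by (simp add: agree_def)
qed

lemma ordprod_hom:
  assumes "\<phi> \<in> Ring.ring_hom (qseries q) (qseries q)"
  shows "\<phi> (ordprod q fs) = ordprod q (map \<phi> fs)"
  using Ring.ring_hom_mult[OF assms] Ring.ring_hom_one[OF assms]
  by (induction fs) (simp_all add: ordprod_Nil ordprod_Cons)

lemma ordprod_antihom:
  assumes q: "q \<noteq> 0" and "\<phi> \<in> Ring.ring_hom (qseries q) (opposite_ring (qseries q))"
  shows "\<phi> (ordprod q fs) = ordprod q (rev (map \<phi> fs))"
  using Ring.ring_hom_mult[OF assms(2)] Ring.ring_hom_one[OF assms(2)]
  by (induction fs) (simp_all add: ordprod_Nil ordprod_Cons ordprod_append[OF q] mult_qseries_one)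

lemma rev_map_upt: "rev (map f [a..<b]) = map (\<lambda>k. f (a + b - Suc k)) [a..<b]"
  by (rule nth_equalityI) (auto simp: rev_nth intro!: arg_cong[of _ _ f])

context
  fixes q :: complex and \<alpha> :: "'n::nontriv mod_ring \<Rightarrow> complex"
  assumes q: "q \<noteq> 0" and \<alpha>: "\<And>i. \<alpha> i \<noteq> 0"
begin

lemma dynkin_pi_alg_iso: "alg_iso (qseries q) (qseries q) (dynkin_pi q \<alpha>)"
  and dynkin_pi_xhat: "dynkin_pi q \<alpha> (xhat \<alpha> i) = xhat \<alpha> (i + 1)"
  using theI'[OF dynkin_pi_ex1[of q \<alpha>, OF q \<alpha>]] by (simp_all add: dynkin_pi_def)

lemma dynkin_s0_alg_iso: "alg_iso (qseries q) (opposite_ring (qseries q)) (dynkin_s0 q \<alpha>)"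
  and dynkin_s0_xhat: "dynkin_s0 q \<alpha> (xhat \<alpha> i) = xhat \<alpha> (- i)"
  using theI'[OF dynkin_s0_ex1[of q \<alpha>, OF q \<alpha>]] by (simp_all add: dynkin_s0_def)

lemma dynkin_pi_hom: "dynkin_pi q \<alpha> \<in> Ring.ring_hom (qseries q) (qseries q)"
  using dynkin_pi_alg_iso by (simp add: alg_iso_def ring_iso_def)

lemma dynkin_s0_hom: "dynkin_s0 q \<alpha> \<in> Ring.ring_hom (qseries q) (opposite_ring (qseries q))"
  using dynkin_s0_alg_iso by (simp add: alg_iso_def ring_iso_def)

lemma dynkin_pi_eneg:
  assumes "no_const z" "no_const (dynkin_pi q \<alpha> z)"
  shows "dynkin_pi q \<alpha> (eneg q z) = eneg q (dynkin_pi q \<alpha> z)"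
proof (rule alg_iso_eneg[OF q dynkin_pi_alg_iso _ _ assms])
  show "dynkin_pi q \<alpha> (z [^]\<^bsub>qseries q\<^esub> n) = dynkin_pi q \<alpha> z [^]\<^bsub>qseries q\<^esub> n" for n :: nat
    using Ring.ring_hom_mult[OF dynkin_pi_hom] Ring.ring_hom_one[OF dynkin_pi_hom]
    by (induction n) simp_all
qed (simp add: qseries_sel)

lemma dynkin_s0_eneg:
  assumes "no_const z" "no_const (dynkin_s0 q \<alpha> z)"
  shows "dynkin_s0 q \<alpha> (eneg q z) = eneg q (dynkin_s0 q \<alpha> z)"
proof (rule alg_iso_eneg[OF q dynkin_s0_alg_iso _ _ assms])
  interpret ring "qseries q :: 'n series ring" by (rule ring_qseries[OF q])
  show "dynkin_s0 q \<alpha> (z [^]\<^bsub>qseries q\<^esub> n) = dynkin_s0 q \<alpha> z [^]\<^bsub>qseries q\<^esub> n" for n :: nat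
  proof (induction n)
    case (Suc n)
    \<comment> \<open>The anti-homomorphism puts the new factor on the other side, which is harmless
      for powers of one element.\<close>
    then show ?case
      using Ring.ring_hom_mult[OF dynkin_s0_hom, of "z [^]\<^bsub>qseries q\<^esub> n" z] nat_pow_Suc2[of "dynkin_s0 q \<alpha> z" n]
      by simp
  qed (use Ring.ring_hom_one[OF dynkin_s0_hom] in simp)
qed (simp add: qseries_sel)

lemma dynkin_pi_desc_prod: "dynkin_pi q \<alpha> (desc_prod q \<alpha> i m) = desc_prod q \<alpha> (i + 1) m"
  unfolding desc_prod_def ordprod_hom[OF dynkin_pi_hom]
  by (simp add: o_def dynkin_pi_xhat algebra_simps del: upt_Suc)

text \<open>Index \<open>i + of_nat m\<close> is chosen because the strings of the lower product
  share the bottom x_i; reflection and reversal give them the common top x_(-i), as in the upper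
  product.\<close>

lemma dynkin_s0_desc_prod: "dynkin_s0 q \<alpha> (desc_prod q \<alpha> (i + of_nat m) m) = desc_prod q \<alpha> (- i) m"
proof -
  have "rev (map (\<lambda>k. dynkin_s0 q \<alpha> (xhat \<alpha> (i + of_nat m - of_nat k))) [0..<m + 1])
      = map (\<lambda>k. xhat \<alpha> (- i - of_nat k)) [0..<m + 1]"
    by (auto simp: rev_map_upt dynkin_s0_xhat of_nat_diff minus_diff_commute simp del: upt_Suc)
  then show ?thesis
    by (simp add: desc_prod_def ordprod_antihom[OF q dynkin_s0_hom] o_def del: upt_Suc)
qed

lemma dynkin_pi_prodB_lower: "dynkin_pi q \<alpha> (prodB_lower q \<alpha> i) = prodB_lower q \<alpha> (i + 1)"
  by (simp add: prodB_lower_def ordprod_hom[OF dynkin_pi_hom] o_def dynkin_pi_eneg no_const_xhat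
      no_const_desc_prod dynkin_pi_xhat dynkin_pi_desc_prod add_ac del: upt_Suc)

lemma dynkin_s0_prodB_lower: "dynkin_s0 q \<alpha> (prodB_lower q \<alpha> i) = prodB_upper q \<alpha> (- i)"
proof -
  \<comment> \<open>Reversal turns k into N - k, and - i - (N - k) = - i + k since N = 0 in the
    index ring.\<close>
  have "rev (map (\<lambda>k. eneg q (xhat \<alpha> (- i - of_nat k))) [1..<CARD('n)])
      = map (\<lambda>k. eneg q (xhat \<alpha> (- i + of_nat k))) [1..<CARD('n)]"
    by (auto simp: rev_map_upt of_nat_diff)
  then show ?thesis
    by (simp add: prodB_lower_def prodB_upper_def ordprod_antihom[OF q dynkin_s0_hom] o_def dynkin_s0_eneg
        no_const_xhat no_const_desc_prod dynkin_s0_xhat dynkin_s0_desc_prod rev_map del: upt_Suc)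
qed

end

lemma shift_invariant_mod_ring:
  fixes f :: "'n::nontriv mod_ring \<Rightarrow> 'a"
  assumes "\<And>p. f (p + 1) = f p"
  shows "f p = f p'"
proof -
  have "f (of_nat k) = f 0" for k
  proof (induction k)
    case (Suc k)
    then show ?case using assms[of "of_nat k"] by (simp add: add.commute)
  qed simp
  moreover have "\<exists>k. r = of_nat k" for r :: "'n mod_ring"
    by (rule exI[of _ "nat (to_int_mod_ring r)"])
      (simp add: of_nat_of_int_mod_ring, transfer, simp)
  ultimately show ?thesis by metis
qed

theorem proposition2p7:
  fixes q :: complex
    and \<alpha> :: "'n::nontriv mod_ring \<Rightarrow> complex"
    and i :: "'n mod_ring"
  assumes "0 < norm q" and "norm q < 1"
    and "CARD('n) \<ge> 3"
    and "\<And>j. \<alpha> j \<noteq> 0"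
  shows "prodA q \<alpha> i = prodB_lower q \<alpha> i
    \<and> prodB_lower q \<alpha> i = prodB_upper q \<alpha> i
    \<and> dynkin_pi q \<alpha> (prodB_lower q \<alpha> i) = prodB_lower q \<alpha> i
    \<and> dynkin_s0 q \<alpha> (prodB_lower q \<alpha> i) = prodB_lower q \<alpha> i"
proof -
  have q: "q \<noteq> 0" using assms(1) by auto
  \<comment> \<open>The two indices are independent, so this one fact yields the equality at
    \<open>i\<close> and both invariances.\<close>
  have lower: "prodB_lower q \<alpha> p = prodB_upper q \<alpha> p'" for p p'
  proof -
    have "prodB_lower q \<alpha> p = prodB_upper q \<alpha> (p - 1)"
      using prodA_eq_prodB_lower[OF q assms(2,3), of \<alpha> p] prodA_eq_prodB_upper[OF q assms(2,3), of \<alpha> "p - 1"]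
      by simp
    also have "\<dots> = prodB_upper q \<alpha> p'"
      by (rule shift_invariant_mod_ring) (rule prodB_upper_shift[OF q assms(2,3)])
    finally show ?thesis .
  qed
  show ?thesis
    using prodA_eq_prodB_lower[OF q assms(2,3), of \<alpha> i] lower
    by (simp add: dynkin_pi_prodB_lower[OF q assms(4)] dynkin_s0_prodB_lower[OF q assms(4)]) (metis lower)
qed

end
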